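(* Let $k$ be a field, let $\mathcal{C}$ be a finite category with exactly one object (i.e. a finite monoid) and let $R:\mathcal{C}\to k\text{-}\mathrm{Alg}$ be a precosheaf of $k$-algebras on $\mathcal{C}$. Then the map $$\Psi: R[\mathcal{C}]\to \Big(\bigotimes_{x\in\mathrm{Ob}\,\mathcal{C}}R(x)\Big)\otimes_{\tau} k\mathcal{C}$$ described in the context is an isomorphism of $k$-algebras.
   Context: Conventions. A finite category is one whose morphisms form a finite set $\mathrm{Mor}\,\mathcal{C}$. For a morphism $f:x\to y$ write $\mathrm{d}(f)=x$ and $\mathrm{c}(f)=y$. A $k$-algebra is a unital associative $k$-algebra, $k\text{-}\mathrm{Alg}$ is the category of $k$-algebras with unital homomorphisms. Tensor products are over $k$. A precosheaf of $k$-algebras on $\mathcal{C}$ is a covariant functor $R:\mathcal{C}\to k\text{-}\mathrm{Alg}$. Category algebra. $k\mathcal{C}$ is the $k$-vector space with basis $\mathrm{Mor}\,\mathcal{C}$ and multiplication $g\cdot f=g\circ f$ if $\mathrm{d}(g)=\mathrm{c}(f)$ and $g\cdot f=0$ otherwise; its identity is $\sum_{x\in\mathrm{Ob}\,\mathcal{C}}1_x$. Skew category algebra. $R[\mathcal{C}]$ is the $k$-vector space $\bigoplus_{f\in\mathrm{Mor}\,\mathcal{C}}R(\mathrm{c}(f))f$, spanned by the elements $rf$ with $f\in\mathrm{Mor}\,\mathcal{C}$, $r\in R(\mathrm{c}(f))$, with multiplication $sg\ast rf=sR(g)(r)\,g\circ f$ if $\mathrm{d}(g)=\mathrm{c}(f)$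 and $0$ otherwise; its identity is $\sum_{x\in\mathrm{Ob}\,\mathcal{C}}1_{R(x)}1_x$. Twisted tensor product. Let $A=\bigotimes_{x\in\mathrm{Ob}\,\mathcal{C}}R(x)$ (with the pointwise multiplication $\mu_A$) and $B=k\mathcal{C}$ (with multiplication $\mu_B$). Let $\tau:B\otimes A\to A\otimes B$ be the map given by $$\tau\Big(f\otimes \bigotimes_{x\in\mathrm{Ob}\,\mathcal{C}}r_x\Big)=\Big(\bigotimes_{t\in\mathrm{Ob}\,\mathcal{C}}r'_t\Big)\otimes f,\qquad r'_t=\begin{cases}R(f)(r_{\mathrm{d}(f)}),& t=\mathrm{c}(f),\\ r_t,& t\neq \mathrm{c}(f).\end{cases}$$ (When $\mathcal{C}$ has a single object $x$, this reads $\tau(f\otimes r)=R(f)(r)\otimes f$ for $r\in R(x)$.) The algebra $A\otimes_\tau B$ is the vector space $A\otimes B$ with multiplication $\mu_\tau=(\mu_A\otimes\mu_B)\circ(\mathrm{id}_A\otimes\tau\otimes\mathrm{id}_B)$ and identity $1_A\otimes 1_B$. The map $\Psi$. It is the $k$-linear map with $\Psi(rf)=\big(\bigotimes_{x\in\mathrm{Ob}\,\mathcal{C}}r_x\big)\otimes f$ for $f\in\mathrm{Mor}\,\mathcal{C}$, $r\in R(\mathrm{c}(f))$, where $r_x=r$ if $x=\mathrm{c}(f)$ and $r_x=1_{R(x)}$ if $x\ne\mathrm{c}(f)$. (When $\mathcal{C}$ has a single object, $\Psi(rf)=r\otimes f$.) *)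

theory Defs
  imports "HOL-Algebra.Algebra"
begin

section \<open>Unital associative algebras\<close>

text \<open>HOL-Algebra's locale \<open>algebra\<close> requires the algebra to be commutative; this one does not.
  The zero algebra is allowed.\<close>

locale unital_algebra = module + M?: ring M +
  assumes smult_mult_left:
      "\<lbrakk>a \<in> carrier R; x \<in> carrier M; y \<in> carrier M\<rbrakk> \<Longrightarrow>
        (a \<odot>\<^bsub>M\<^esub> x) \<otimes>\<^bsub>M\<^esub> y = a \<odot>\<^bsub>M\<^esub> (x \<otimes>\<^bsub>M\<^esub> y)"
    and smult_mult_right:
      "\<lbrakk>a \<in> carrier R; x \<in> carrier M; y \<in> carrier M\<rbrakk> \<Longrightarrow>
        x \<otimes>\<^bsub>M\<^esub> (a \<odot>\<^bsub>M\<^esub> y) = a \<odot>\<^bsub>M\<^esub> (x \<otimes>\<^bsub>M\<^esub> y)"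

definition alg_hom ::
  "('k, 'z) ring_scheme \<Rightarrow> ('k, 'a) module \<Rightarrow> ('k, 'b) module \<Rightarrow> ('a \<Rightarrow> 'b) set" where
  "alg_hom K A B =
    {h \<in> ring_hom A B. \<forall>c\<in>carrier K. \<forall>x\<in>carrier A. h (c \<odot>\<^bsub>A\<^esub> x) = c \<odot>\<^bsub>B\<^esub> h x}"

definition alg_iso ::
  "('k, 'z) ring_scheme \<Rightarrow> ('k, 'a) module \<Rightarrow> ('k, 'b) module \<Rightarrow> ('a \<Rightarrow> 'b) set" where
  "alg_iso K A B = {h \<in> alg_hom K A B. bij_betw h (carrier A) (carrier B)}"

section \<open>Categories and precosheaves of algebras\<close>

record ('o, 'm) category =
  Ob :: "'o set"
  Mor :: "'m set"
  dom :: "'m \<Rightarrow> 'o"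
  cod :: "'m \<Rightarrow> 'o"
  ident :: "'o \<Rightarrow> 'm"
  comp :: "'m \<Rightarrow> 'm \<Rightarrow> 'm"

text \<open>\<open>comp C g f\<close> is \<open>g\<close> after \<open>f\<close>; it is only meaningful when \<open>dom C g = cod C f\<close>.\<close>

locale category =
  fixes C :: "('o, 'm) category"
  assumes dom_closed: "f \<in> Mor C \<Longrightarrow> dom C f \<in> Ob C"
    and cod_closed: "f \<in> Mor C \<Longrightarrow> cod C f \<in> Ob C"
    and ident_closed: "x \<in> Ob C \<Longrightarrow> ident C x \<in> Mor C"
    and dom_ident: "x \<in> Ob C \<Longrightarrow> dom C (ident C x) = x"
    and cod_ident: "x \<in> Ob C \<Longrightarrow> cod C (ident C x) = x"
    and comp_closed: "\<lbrakk>g \<in> Mor C; f \<in> Mor C; dom C g = cod C f\<rbrakk> \<Longrightarrow> comp C g f \<in> Mor C"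
    and dom_comp: "\<lbrakk>g \<in> Mor C; f \<in> Mor C; dom C g = cod C f\<rbrakk> \<Longrightarrow> dom C (comp C g f) = dom C f"
    and cod_comp: "\<lbrakk>g \<in> Mor C; f \<in> Mor C; dom C g = cod C f\<rbrakk> \<Longrightarrow> cod C (comp C g f) = cod C g"
    and comp_assoc:
      "\<lbrakk>h \<in> Mor C; g \<in> Mor C; f \<in> Mor C; dom C h = cod C g; dom C g = cod C f\<rbrakk> \<Longrightarrow>
        comp C (comp C h g) f = comp C h (comp C g f)"
    and comp_ident_left: "f \<in> Mor C \<Longrightarrow> comp C (ident C (cod C f)) f = f"
    and comp_ident_right: "f \<in> Mor C \<Longrightarrow> comp C f (ident C (dom C f)) = f"

locale finite_category = category +
  assumes finite_Mor: "finite (Mor C)"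

text \<open>A covariant functor, with values \<open>R x\<close> on objects and \<open>F f\<close> on morphisms.\<close>

locale precosheaf = category C + K: field K
  for K :: "('k, 'z) ring_scheme" and C :: "('o, 'm) category" +
  fixes R :: "'o \<Rightarrow> ('k, 'a) module"
    and F :: "'m \<Rightarrow> 'a \<Rightarrow> 'a"
  assumes algebra_obj: "x \<in> Ob C \<Longrightarrow> unital_algebra K (R x)"
    and hom_mor: "f \<in> Mor C \<Longrightarrow> F f \<in> alg_hom K (R (dom C f)) (R (cod C f))"
    and mor_ident: "\<lbrakk>x \<in> Ob C; r \<in> carrier (R x)\<rbrakk> \<Longrightarrow> F (ident C x) r = r"
    and mor_comp:
      "\<lbrakk>g \<in> Mor C; f \<in> Mor C; dom C g = cod C f; r \<in> carrier (R (dom C f))\<rbrakk> \<Longrightarrow>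
        F (comp C g f) r = F g (F f r)"

section \<open>Direct sums, free modules and quotients\<close>

text \<open>Modules are records that extend rings. Where only the module structure is
  meaningful, the fields \<open>mult\<close> and \<open>one\<close> are left \<open>undefined\<close>.\<close>

definition direct_sum ::
  "('k, 'z) ring_scheme \<Rightarrow> 'i set \<Rightarrow> ('i \<Rightarrow> ('k, 'a) module) \<Rightarrow> ('k, 'i \<Rightarrow> 'a) module" where
  "direct_sum K I M =
    \<lparr>carrier = {u \<in> \<Pi>\<^sub>E i\<in>I. carrier (M i). finite {i \<in> I. u i \<noteq> \<zero>\<^bsub>M i\<^esub>}},
     monoid.mult = undefined, one = undefined,
     ring.zero = (\<lambda>i\<in>I. \<zero>\<^bsub>M i\<^esub>),
     add = (\<lambda>u v. \<lambda>i\<in>I. u i \<oplus>\<^bsub>M i\<^esub> v i),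
     smult = (\<lambda>c u. \<lambda>i\<in>I. c \<odot>\<^bsub>M i\<^esub> u i)\<rparr>"

text \<open>The element of \<open>direct_sum K I M\<close> with \<open>a\<close> in the component \<open>i\<close> and zero elsewhere.\<close>

definition single :: "'i set \<Rightarrow> ('i \<Rightarrow> ('k, 'a) module) \<Rightarrow> 'i \<Rightarrow> 'a \<Rightarrow> 'i \<Rightarrow> 'a" where
  "single I M i a = (\<lambda>j\<in>I. if j = i then a else \<zero>\<^bsub>M j\<^esub>)"

definition self_module :: "('k, 'z) ring_scheme \<Rightarrow> ('k, 'k) module" where
  "self_module K =
    \<lparr>carrier = carrier K, monoid.mult = monoid.mult K, one = one K, ring.zero = ring.zero K, add = add K,
     smult = monoid.mult K\<rparr>"

definition free_module :: "('k, 'z) ring_scheme \<Rightarrow> 's set \<Rightarrow> ('k, 's \<Rightarrow> 'k) module" where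
  "free_module K S = direct_sum K S (\<lambda>_. self_module K)"

definition basis_elem :: "('k, 'z) ring_scheme \<Rightarrow> 's set \<Rightarrow> 's \<Rightarrow> 's \<Rightarrow> 'k" where
  "basis_elem K S s = single S (\<lambda>_. self_module K) s \<one>\<^bsub>K\<^esub>"

definition module_span ::
  "('k, 'z) ring_scheme \<Rightarrow> ('k, 'a) module \<Rightarrow> 'a set \<Rightarrow> 'a set" where
  "module_span K M G = \<Inter>{N. submodule N K M \<and> G \<subseteq> N}"

definition quotient_module ::
  "('k, 'z) ring_scheme \<Rightarrow> ('k, 'a) module \<Rightarrow> 'a set \<Rightarrow> ('k, 'a set) module" where
  "quotient_module K M N =
    \<lparr>carrier = a_rcosets\<^bsub>M\<^esub> N,
     monoid.mult = undefined, one = undefined,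
     ring.zero = N,
     add = set_add M,
     smult = (\<lambda>c U. \<Union>x\<in>U. N +>\<^bsub>M\<^esub> (c \<odot>\<^bsub>M\<^esub> x))\<rparr>"

text \<open>\<open>linear_ext K S P \<phi>\<close> is the linear map from \<open>free_module K S\<close> to \<open>P\<close> extending \<open>\<phi>\<close>, and
  \<open>class_lift\<close> is the map it induces on a quotient of \<open>free_module K S\<close>: the common value of
  \<open>linear_ext K S P \<phi>\<close> on the coset \<open>U\<close>. If \<open>\<phi>\<close> does not respect the relations, there is no
  common value and \<open>class_lift\<close> is unspecified.\<close>

definition linear_ext ::
  "('k, 'z) ring_scheme \<Rightarrow> 's set \<Rightarrow> ('k, 'p) module \<Rightarrow> ('s \<Rightarrow> 'p) \<Rightarrow> ('s \<Rightarrow> 'k) \<Rightarrow> 'p" where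
  "linear_ext K S P \<phi> v = (\<Oplus>\<^bsub>P\<^esub>s\<in>{s \<in> S. v s \<noteq> \<zero>\<^bsub>K\<^esub>}. v s \<odot>\<^bsub>P\<^esub> \<phi> s)"

definition class_lift ::
  "('k, 'z) ring_scheme \<Rightarrow> 's set \<Rightarrow> ('k, 'p) module \<Rightarrow> ('s \<Rightarrow> 'p) \<Rightarrow> ('s \<Rightarrow> 'k) set \<Rightarrow> 'p" where
  "class_lift K S P \<phi> U = the_elem (linear_ext K S P \<phi> ` U)"

section \<open>The tensor product of two modules\<close>

definition tensor_relations ::
  "('k, 'z) ring_scheme \<Rightarrow> ('k, 'a) module \<Rightarrow> ('k, 'b) module \<Rightarrow> ('a \<times> 'b \<Rightarrow> 'k) set" where
  "tensor_relations K M N =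
    (let S = carrier M \<times> carrier N; L = free_module K S; e = basis_elem K S in
      {e (m \<oplus>\<^bsub>M\<^esub> m', n) \<ominus>\<^bsub>L\<^esub> (e (m, n) \<oplus>\<^bsub>L\<^esub> e (m', n)) |m m' n.
          m \<in> carrier M \<and> m' \<in> carrier M \<and> n \<in> carrier N} \<union>
      {e (m, n \<oplus>\<^bsub>N\<^esub> n') \<ominus>\<^bsub>L\<^esub> (e (m, n) \<oplus>\<^bsub>L\<^esub> e (m, n')) |m n n'.
          m \<in> carrier M \<and> n \<in> carrier N \<and> n' \<in> carrier N} \<union>
      {e (c \<odot>\<^bsub>M\<^esub> m, n) \<ominus>\<^bsub>L\<^esub> (c \<odot>\<^bsub>L\<^esub> e (m, n)) |c m n.
          c \<in> carrier K \<and> m \<in> carrier M \<and> n \<in> carrier N} \<union>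
      {e (m, c \<odot>\<^bsub>N\<^esub> n) \<ominus>\<^bsub>L\<^esub> (c \<odot>\<^bsub>L\<^esub> e (m, n)) |c m n.
          c \<in> carrier K \<and> m \<in> carrier M \<and> n \<in> carrier N})"

definition tensor_null ::
  "('k, 'z) ring_scheme \<Rightarrow> ('k, 'a) module \<Rightarrow> ('k, 'b) module \<Rightarrow> ('a \<times> 'b \<Rightarrow> 'k) set" where
  "tensor_null K M N =
    module_span K (free_module K (carrier M \<times> carrier N)) (tensor_relations K M N)"

definition tensor ::
  "('k, 'z) ring_scheme \<Rightarrow> ('k, 'a) module \<Rightarrow> ('k, 'b) module \<Rightarrow>
    ('k, ('a \<times> 'b \<Rightarrow> 'k) set) module" where
  "tensor K M N =
    quotient_module K (free_module K (carrier M \<times> carrier N)) (tensor_null K M N)"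

definition pure_tensor ::
  "('k, 'z) ring_scheme \<Rightarrow> ('k, 'a) module \<Rightarrow> ('k, 'b) module \<Rightarrow> 'a \<Rightarrow> 'b \<Rightarrow>
    ('a \<times> 'b \<Rightarrow> 'k) set" where
  "pure_tensor K M N m n =
    tensor_null K M N +>\<^bsub>free_module K (carrier M \<times> carrier N)\<^esub>
      basis_elem K (carrier M \<times> carrier N) (m, n)"

text \<open>The linear map on \<open>tensor K M N\<close> that sends \<open>m \<otimes> n\<close> to \<open>\<phi> m n\<close>, for bilinear \<open>\<phi>\<close>.\<close>

definition tensor_lift ::
  "('k, 'z) ring_scheme \<Rightarrow> ('k, 'a) module \<Rightarrow> ('k, 'b) module \<Rightarrow> ('k, 'p) module \<Rightarrow>
    ('a \<Rightarrow> 'b \<Rightarrow> 'p) \<Rightarrow> ('a \<times> 'b \<Rightarrow> 'k) set \<Rightarrow> 'p" where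
  "tensor_lift K M N P \<phi> =
    class_lift K (carrier M \<times> carrier N) P (\<lambda>(m, n). \<phi> m n)"

definition tensor_map ::
  "('k, 'z) ring_scheme \<Rightarrow> ('k, 'a) module \<Rightarrow> ('k, 'b) module \<Rightarrow>
    ('k, 'c) module \<Rightarrow> ('k, 'd) module \<Rightarrow> ('a \<Rightarrow> 'c) \<Rightarrow> ('b \<Rightarrow> 'd) \<Rightarrow>
    ('a \<times> 'b \<Rightarrow> 'k) set \<Rightarrow> ('c \<times> 'd \<Rightarrow> 'k) set" where
  "tensor_map K M N M' N' f g =
    tensor_lift K M N (tensor K M' N') (\<lambda>m n. pure_tensor K M' N' (f m) (g n))"

text \<open>The canonical isomorphism from \<open>(M \<otimes> N) \<otimes> P\<close> to \<open>M \<otimes> (N \<otimes> P)\<close>.\<close>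

definition tensor_assoc ::
  "('k, 'z) ring_scheme \<Rightarrow> ('k, 'a) module \<Rightarrow> ('k, 'b) module \<Rightarrow> ('k, 'c) module \<Rightarrow>
    (('a \<times> 'b \<Rightarrow> 'k) set \<times> 'c \<Rightarrow> 'k) set \<Rightarrow> ('a \<times> ('b \<times> 'c \<Rightarrow> 'k) set \<Rightarrow> 'k) set" where
  "tensor_assoc K M N P =
    tensor_lift K (tensor K M N) P (tensor K M (tensor K N P))
      (\<lambda>u p. tensor_lift K M N (tensor K M (tensor K N P))
        (\<lambda>m n. pure_tensor K M (tensor K N P) m (pure_tensor K N P n p)) u)"

text \<open>The canonical isomorphism from \<open>M \<otimes> (N \<otimes> P)\<close> to \<open>(M \<otimes> N) \<otimes> P\<close>.\<close>

definition tensor_assoc_inv ::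
  "('k, 'z) ring_scheme \<Rightarrow> ('k, 'a) module \<Rightarrow> ('k, 'b) module \<Rightarrow> ('k, 'c) module \<Rightarrow>
    ('a \<times> ('b \<times> 'c \<Rightarrow> 'k) set \<Rightarrow> 'k) set \<Rightarrow> (('a \<times> 'b \<Rightarrow> 'k) set \<times> 'c \<Rightarrow> 'k) set" where
  "tensor_assoc_inv K M N P =
    tensor_lift K M (tensor K N P) (tensor K (tensor K M N) P)
      (\<lambda>m w. tensor_lift K N P (tensor K (tensor K M N) P)
        (\<lambda>n p. pure_tensor K (tensor K M N) P (pure_tensor K M N m n) p) w)"

section \<open>The tensor product of a family of modules\<close>

definition tensor_family_relations ::
  "('k, 'z) ring_scheme \<Rightarrow> 'i set \<Rightarrow> ('i \<Rightarrow> ('k, 'a) module) \<Rightarrow> (('i \<Rightarrow> 'a) \<Rightarrow> 'k) set" where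
  "tensor_family_relations K I M =
    (let S = (\<Pi>\<^sub>E i\<in>I. carrier (M i)); L = free_module K S; e = basis_elem K S in
      {e (r(i := a \<oplus>\<^bsub>M i\<^esub> b)) \<ominus>\<^bsub>L\<^esub> (e (r(i := a)) \<oplus>\<^bsub>L\<^esub> e (r(i := b))) |r i a b.
          r \<in> S \<and> i \<in> I \<and> a \<in> carrier (M i) \<and> b \<in> carrier (M i)} \<union>
      {e (r(i := c \<odot>\<^bsub>M i\<^esub> a)) \<ominus>\<^bsub>L\<^esub> (c \<odot>\<^bsub>L\<^esub> e (r(i := a))) |r i c a.
          r \<in> S \<and> i \<in> I \<and> c \<in> carrier K \<and> a \<in> carrier (M i)})"

definition tensor_family_null ::
  "('k, 'z) ring_scheme \<Rightarrow> 'i set \<Rightarrow> ('i \<Rightarrow> ('k, 'a) module) \<Rightarrow> (('i \<Rightarrow> 'a) \<Rightarrow> 'k) set" where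
  "tensor_family_null K I M =
    module_span K (free_module K (\<Pi>\<^sub>E i\<in>I. carrier (M i))) (tensor_family_relations K I M)"

definition tensor_family ::
  "('k, 'z) ring_scheme \<Rightarrow> 'i set \<Rightarrow> ('i \<Rightarrow> ('k, 'a) module) \<Rightarrow>
    ('k, (('i \<Rightarrow> 'a) \<Rightarrow> 'k) set) module" where
  "tensor_family K I M =
    quotient_module K (free_module K (\<Pi>\<^sub>E i\<in>I. carrier (M i))) (tensor_family_null K I M)"

definition pure_tensor_family ::
  "('k, 'z) ring_scheme \<Rightarrow> 'i set \<Rightarrow> ('i \<Rightarrow> ('k, 'a) module) \<Rightarrow> ('i \<Rightarrow> 'a) \<Rightarrow>
    (('i \<Rightarrow> 'a) \<Rightarrow> 'k) set" where
  "pure_tensor_family K I M r =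
    tensor_family_null K I M +>\<^bsub>free_module K (\<Pi>\<^sub>E i\<in>I. carrier (M i))\<^esub>
      basis_elem K (\<Pi>\<^sub>E i\<in>I. carrier (M i)) r"

text \<open>The linear map on \<open>tensor_family K I M\<close> that sends the pure tensor of \<open>r\<close> to \<open>\<phi> r\<close>, for
  multilinear \<open>\<phi>\<close>.\<close>

definition tensor_family_lift ::
  "('k, 'z) ring_scheme \<Rightarrow> 'i set \<Rightarrow> ('i \<Rightarrow> ('k, 'a) module) \<Rightarrow> ('k, 'p) module \<Rightarrow>
    (('i \<Rightarrow> 'a) \<Rightarrow> 'p) \<Rightarrow> (('i \<Rightarrow> 'a) \<Rightarrow> 'k) set \<Rightarrow> 'p" where
  "tensor_family_lift K I M P \<phi> = class_lift K (\<Pi>\<^sub>E i\<in>I. carrier (M i)) P \<phi>"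

text \<open>The tensor product of a family of algebras, with the pointwise multiplication.\<close>

definition tensor_family_algebra ::
  "('k, 'z) ring_scheme \<Rightarrow> 'i set \<Rightarrow> ('i \<Rightarrow> ('k, 'a) module) \<Rightarrow>
    ('k, (('i \<Rightarrow> 'a) \<Rightarrow> 'k) set) module" where
  "tensor_family_algebra K I M =
    (let T = tensor_family K I M in
      T\<lparr>monoid.mult := (\<lambda>U V. tensor_family_lift K I M T
            (\<lambda>r. tensor_family_lift K I M T
              (\<lambda>s. pure_tensor_family K I M (\<lambda>i\<in>I. r i \<otimes>\<^bsub>M i\<^esub> s i)) V) U),
        one := pure_tensor_family K I M (\<lambda>i\<in>I. \<one>\<^bsub>M i\<^esub>)\<rparr>)"

section \<open>Category algebras and skew category algebras\<close>

text \<open>The multiplications below are the bilinear extensions of the products of the basis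
  elements \<open>f\<close> and of the elements \<open>r f\<close>, respectively.\<close>

definition category_algebra ::
  "('k, 'z) ring_scheme \<Rightarrow> ('o, 'm) category \<Rightarrow> ('k, 'm \<Rightarrow> 'k) module" where
  "category_algebra K C =
    (let V = free_module K (Mor C); e = basis_elem K (Mor C) in
      V\<lparr>monoid.mult := (\<lambda>v u. \<Oplus>\<^bsub>V\<^esub>g\<in>Mor C. \<Oplus>\<^bsub>V\<^esub>f\<in>Mor C.
            if dom C g = cod C f then (v g \<otimes>\<^bsub>K\<^esub> u f) \<odot>\<^bsub>V\<^esub> e (comp C g f) else \<zero>\<^bsub>V\<^esub>),
        one := (\<Oplus>\<^bsub>V\<^esub>x\<in>Ob C. e (ident C x))\<rparr>)"

definition skew_category_algebra ::
  "('k, 'z) ring_scheme \<Rightarrow> ('o, 'm) category \<Rightarrow> ('o \<Rightarrow> ('k, 'a) module) \<Rightarrow> ('m \<Rightarrow> 'a \<Rightarrow> 'a) \<Rightarrow>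
    ('k, 'm \<Rightarrow> 'a) module" where
  "skew_category_algebra K C R F =
    (let V = direct_sum K (Mor C) (\<lambda>f. R (cod C f)); e = single (Mor C) (\<lambda>f. R (cod C f)) in
      V\<lparr>monoid.mult := (\<lambda>v u. \<Oplus>\<^bsub>V\<^esub>g\<in>Mor C. \<Oplus>\<^bsub>V\<^esub>f\<in>Mor C.
            if dom C g = cod C f
            then e (comp C g f) (v g \<otimes>\<^bsub>R (cod C g)\<^esub> F g (u f)) else \<zero>\<^bsub>V\<^esub>),
        one := (\<Oplus>\<^bsub>V\<^esub>x\<in>Ob C. e (ident C x) \<one>\<^bsub>R x\<^esub>)\<rparr>)"

section \<open>The twisted tensor product\<close>

text \<open>The composition \<open>(\<mu>\<^sub>A \<otimes> \<mu>\<^sub>B) \<circ> (id \<otimes> \<tau> \<otimes> id)\<close>, as a map from \<open>(A \<otimes> B) \<otimes> (A \<otimes> B)\<close> to \<open>A \<otimes> B\<close>,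
  with the rebracketings written out:
  \<open>(A \<otimes> B) \<otimes> (A \<otimes> B) \<rightarrow> A \<otimes> (B \<otimes> (A \<otimes> B)) \<rightarrow> A \<otimes> ((B \<otimes> A) \<otimes> B) \<rightarrow> A \<otimes> ((A \<otimes> B) \<otimes> B)
    \<rightarrow> A \<otimes> (A \<otimes> (B \<otimes> B)) \<rightarrow> (A \<otimes> A) \<otimes> (B \<otimes> B) \<rightarrow> A \<otimes> B\<close>.\<close>

definition twisted_mult ::
  "('k, 'z) ring_scheme \<Rightarrow> ('k, 'a) module \<Rightarrow> ('k, 'b) module \<Rightarrow>
    (('b \<times> 'a \<Rightarrow> 'k) set \<Rightarrow> ('a \<times> 'b \<Rightarrow> 'k) set) \<Rightarrow>
    (('a \<times> 'b \<Rightarrow> 'k) set \<times> ('a \<times> 'b \<Rightarrow> 'k) set \<Rightarrow> 'k) set \<Rightarrow> ('a \<times> 'b \<Rightarrow> 'k) set" where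
  "twisted_mult K A B \<tau> =
    (let AB = tensor K A B; BA = tensor K B A; AA = tensor K A A; BB = tensor K B B in
      tensor_map K AA BB A B
        (tensor_lift K A A A (\<lambda>x y. x \<otimes>\<^bsub>A\<^esub> y)) (tensor_lift K B B B (\<lambda>x y. x \<otimes>\<^bsub>B\<^esub> y)) \<circ>
      tensor_assoc_inv K A A BB \<circ>
      tensor_map K A (tensor K AB B) A (tensor K A BB) id (tensor_assoc K A B B) \<circ>
      tensor_map K A (tensor K BA B) A (tensor K AB B) id (tensor_map K BA B AB B \<tau> id) \<circ>
      tensor_map K A (tensor K B AB) A (tensor K BA B) id (tensor_assoc_inv K B A B) \<circ>
      tensor_assoc K A B AB)"

definition twisted_tensor ::
  "('k, 'z) ring_scheme \<Rightarrow> ('k, 'a) module \<Rightarrow> ('k, 'b) module \<Rightarrow>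
    (('b \<times> 'a \<Rightarrow> 'k) set \<Rightarrow> ('a \<times> 'b \<Rightarrow> 'k) set) \<Rightarrow> ('k, ('a \<times> 'b \<Rightarrow> 'k) set) module" where
  "twisted_tensor K A B \<tau> =
    (tensor K A B)
      \<lparr>monoid.mult := (\<lambda>x y. twisted_mult K A B \<tau> (pure_tensor K (tensor K A B) (tensor K A B) x y)),
       one := pure_tensor K A B \<one>\<^bsub>A\<^esub> \<one>\<^bsub>B\<^esub>\<rparr>"

text \<open>The family \<open>r'\<close> in the formula \<open>\<tau> (f \<otimes> \<Otimes>r) = \<Otimes>r' \<otimes> f\<close>.\<close>

definition twist_family ::
  "('o, 'm) category \<Rightarrow> ('m \<Rightarrow> 'a \<Rightarrow> 'a) \<Rightarrow> 'm \<Rightarrow> ('o \<Rightarrow> 'a) \<Rightarrow> 'o \<Rightarrow> 'a" where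
  "twist_family C F f r = (\<lambda>t\<in>Ob C. if t = cod C f then F f (r (dom C f)) else r t)"

text \<open>If \<open>f\<close> is not an endomorphism, \<open>r'\<close> does not depend multilinearly on \<open>r\<close>, so that the formula
  for \<open>\<tau>\<close> need not define a linear map. It does when the category has exactly one object.\<close>

definition twist ::
  "('k, 'z) ring_scheme \<Rightarrow> ('o, 'm) category \<Rightarrow> ('o \<Rightarrow> ('k, 'a) module) \<Rightarrow> ('m \<Rightarrow> 'a \<Rightarrow> 'a) \<Rightarrow>
    (('m \<Rightarrow> 'k) \<times> (('o \<Rightarrow> 'a) \<Rightarrow> 'k) set \<Rightarrow> 'k) set \<Rightarrow>
    ((('o \<Rightarrow> 'a) \<Rightarrow> 'k) set \<times> ('m \<Rightarrow> 'k) \<Rightarrow> 'k) set" where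
  "twist K C R F =
    (let A = tensor_family_algebra K (Ob C) R; B = category_algebra K C; AB = tensor K A B in
      tensor_lift K B A AB
        (\<lambda>b a. \<Oplus>\<^bsub>AB\<^esub>f\<in>Mor C. b f \<odot>\<^bsub>AB\<^esub>
          tensor_family_lift K (Ob C) R AB
            (\<lambda>r. pure_tensor K A B (pure_tensor_family K (Ob C) R (twist_family C F f r))
              (basis_elem K (Mor C) f)) a))"

definition twisted_category_algebra ::
  "('k, 'z) ring_scheme \<Rightarrow> ('o, 'm) category \<Rightarrow> ('o \<Rightarrow> ('k, 'a) module) \<Rightarrow> ('m \<Rightarrow> 'a \<Rightarrow> 'a) \<Rightarrow>
    ('k, ((('o \<Rightarrow> 'a) \<Rightarrow> 'k) set \<times> ('m \<Rightarrow> 'k) \<Rightarrow> 'k) set) module" where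
  "twisted_category_algebra K C R F =
    twisted_tensor K (tensor_family_algebra K (Ob C) R) (category_algebra K C) (twist K C R F)"

section \<open>The comparison map\<close>

text \<open>The linear extension of \<open>r f \<mapsto> \<Otimes>r\<^sub>x \<otimes> f\<close>; an element \<open>u\<close> of the skew category algebra is the
  sum of the elements \<open>u f\<close> placed at \<open>f\<close>.\<close>

definition Psi ::
  "('k, 'z) ring_scheme \<Rightarrow> ('o, 'm) category \<Rightarrow> ('o \<Rightarrow> ('k, 'a) module) \<Rightarrow>
    ('m \<Rightarrow> 'a) \<Rightarrow> ((('o \<Rightarrow> 'a) \<Rightarrow> 'k) set \<times> ('m \<Rightarrow> 'k) \<Rightarrow> 'k) set" where
  "Psi K C R u =
    (let A = tensor_family_algebra K (Ob C) R; B = category_algebra K C in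
      \<Oplus>\<^bsub>tensor K A B\<^esub>f\<in>Mor C.
        pure_tensor K A B
          (pure_tensor_family K (Ob C) R (\<lambda>x\<in>Ob C. if x = cod C f then u f else \<one>\<^bsub>R x\<^esub>))
          (basis_elem K (Mor C) f))"

end

theory Submission
  imports Defs
begin

text \<open>Let \<open>x\<close> be the only object. The tensor product of the family \<open>R\<close> is isomorphic to \<open>R x\<close> through
  \<open>\<iota> a = \<Otimes>a\<close>, so \<open>\<Psi>\<close> sends \<open>r f\<close> to \<open>\<iota> r \<otimes> f\<close> and the linear map induced by
  \<open>\<iota> r \<otimes> f \<mapsto> r f\<close> is inverse to it. On these generators \<open>\<mu>\<^sub>\<tau>\<close> yields
  \<open>(\<iota> s \<otimes> g) (\<iota> r \<otimes> f) = \<iota> (s F(g)(r)) \<otimes> g f\<close>, the image of the product of \<open>s g\<close> and \<open>r f\<close>, so by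
  bilinearity \<open>\<Psi>\<close> is multiplicative. Associativity and unitality of \<open>\<mu>\<^sub>\<tau>\<close> are transported along
  \<open>\<Psi>\<close> from the skew category algebra, where they are checked on the elements \<open>r f\<close>.\<close>

text \<open>The obstacle: every tensor product here is a concrete quotient of the free module on all
  pairs or families, and a map out of it, \<open>class_lift\<close>, picks the common value on a
  coset by \<open>the_elem\<close>. Nothing is known about such a map until it is shown to respect
  the relations. So each map is first derived from a bilinear or multilinear one; afterwards only
  its linearity and its values on pure tensors are used. This suffices because the set on which two
  linear maps agree is a submodule, so it is enough to find the generators in it. In the same way
  the composite of six maps behind \<open>\<mu>\<^sub>\<tau>\<close> is evaluated only where
  \<open>\<tau>\<close> returns a single pure tensor. The single object enters twice: the twisted
  family becomes the constant family of \<open>F f r\<close>, which is linear in \<open>r\<close>,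
  and any two morphisms are composable, so no vanishing products have to be matched.\<close>

lemma module_mult_one_update [simp]:
  "module K (M\<lparr>monoid.mult := m, one := e\<rparr>) \<longleftrightarrow> module K M"
proof -
  have "abelian_group (M\<lparr>monoid.mult := m, one := e\<rparr>) \<longleftrightarrow> abelian_group M"
    by (simp add: abelian_group_def abelian_monoid_def abelian_group_axioms_def)
  then show ?thesis
    by (simp add: module_def module_axioms_def)
qed

subsection \<open>Linear and bilinear maps\<close>

text \<open>Only addition and scalar multiplication on the carriers enter, so the notion is blind to
  values outside the carrier and to the fields \<open>mult\<close> and \<open>one\<close>. An
  algebra built by a record update thus has the same linear maps as its underlying module.\<close>

definition linear_map ::
  "('k, 'z) ring_scheme \<Rightarrow> ('k, 'a) module \<Rightarrow> ('k, 'b) module \<Rightarrow> ('a \<Rightarrow> 'b) \<Rightarrow> bool" where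
  "linear_map K M N h \<longleftrightarrow>
    (\<forall>x\<in>carrier M. h x \<in> carrier N) \<and>
    (\<forall>x\<in>carrier M. \<forall>y\<in>carrier M. h (x \<oplus>\<^bsub>M\<^esub> y) = h x \<oplus>\<^bsub>N\<^esub> h y) \<and>
    (\<forall>c\<in>carrier K. \<forall>x\<in>carrier M. h (c \<odot>\<^bsub>M\<^esub> x) = c \<odot>\<^bsub>N\<^esub> h x)"

lemma linear_mapI:
  assumes "\<And>x. x \<in> carrier M \<Longrightarrow> h x \<in> carrier N"
    and "\<And>x y. \<lbrakk>x \<in> carrier M; y \<in> carrier M\<rbrakk> \<Longrightarrow> h (x \<oplus>\<^bsub>M\<^esub> y) = h x \<oplus>\<^bsub>N\<^esub> h y"
    and "\<And>c x. \<lbrakk>c \<in> carrier K; x \<in> carrier M\<rbrakk> \<Longrightarrow> h (c \<odot>\<^bsub>M\<^esub> x) = c \<odot>\<^bsub>N\<^esub> h x"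
  shows "linear_map K M N h"
  using assms by (simp add: linear_map_def)

lemma linear_map_closed: "\<lbrakk>linear_map K M N h; x \<in> carrier M\<rbrakk> \<Longrightarrow> h x \<in> carrier N"
  and linear_map_add: "\<lbrakk>linear_map K M N h; x \<in> carrier M; y \<in> carrier M\<rbrakk> \<Longrightarrow>
    h (x \<oplus>\<^bsub>M\<^esub> y) = h x \<oplus>\<^bsub>N\<^esub> h y"
  and linear_map_smult: "\<lbrakk>linear_map K M N h; c \<in> carrier K; x \<in> carrier M\<rbrakk> \<Longrightarrow>
    h (c \<odot>\<^bsub>M\<^esub> x) = c \<odot>\<^bsub>N\<^esub> h x"
  by (simp_all add: linear_map_def)

lemma linear_map_cong:
  assumes "module K M" "\<And>x. x \<in> carrier M \<Longrightarrow> h x = h' x"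
  shows "linear_map K M N h \<longleftrightarrow> linear_map K M N h'"
proof -
  interpret module K M by fact
  show ?thesis by (simp add: linear_map_def assms(2) cong: ball_cong)
qed

lemma linear_map_mult_one_update [simp]:
  "linear_map K (M\<lparr>monoid.mult := m, one := e\<rparr>) N h \<longleftrightarrow> linear_map K M N h"
  "linear_map K P (Q\<lparr>monoid.mult := m', one := e'\<rparr>) h' \<longleftrightarrow> linear_map K P Q h'"
  by (simp_all add: linear_map_def)

lemma linear_map_id: "linear_map K M M (\<lambda>x. x)"
  by (simp add: linear_map_def)

lemma linear_map_comp:
  "\<lbrakk>linear_map K M N f; linear_map K N P g\<rbrakk> \<Longrightarrow> linear_map K M P (\<lambda>x. g (f x))"
  by (simp add: linear_map_def)

lemma linear_map_zero:
  assumes "module K M" "module K N" "linear_map K M N h"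
  shows "h \<zero>\<^bsub>M\<^esub> = \<zero>\<^bsub>N\<^esub>"
proof -
  interpret M: module K M by fact
  interpret N: module K N by fact
  \<comment> \<open>\<open>linear_map\<close> has no clause for zero, so zero is produced as a
    multiple by the scalar zero.\<close>
  have "h (\<zero>\<^bsub>K\<^esub> \<odot>\<^bsub>M\<^esub> \<zero>\<^bsub>M\<^esub>) = \<zero>\<^bsub>K\<^esub> \<odot>\<^bsub>N\<^esub> h \<zero>\<^bsub>M\<^esub>"
    using assms(3) by (intro linear_map_smult) auto
  then show ?thesis
    using linear_map_closed[OF assms(3), of "\<zero>\<^bsub>M\<^esub>"] by simp
qed

lemma linear_map_minus:
  assumes "module K M" "module K N" "linear_map K M N h" "x \<in> carrier M" "y \<in> carrier M"
  shows "h (x \<ominus>\<^bsub>M\<^esub> y) = h x \<ominus>\<^bsub>N\<^esub> h y"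
proof -
  interpret M: module K M by fact
  interpret N: module K N by fact
  have "h (\<ominus>\<^bsub>M\<^esub> y) = \<ominus>\<^bsub>N\<^esub> h y"
    using M.smult_l_minus[of "\<one>\<^bsub>K\<^esub>" y] N.smult_l_minus[of "\<one>\<^bsub>K\<^esub>" "h y"]
      linear_map_smult[OF assms(3), of "\<ominus>\<^bsub>K\<^esub> \<one>\<^bsub>K\<^esub>" y] linear_map_closed[OF assms(3,5)] assms(5)
    by simp
  then show ?thesis
    using assms by (simp add: a_minus_def linear_map_add)
qed

lemma linear_map_finsum:
  assumes "module K M" "module K N" "linear_map K M N h" "finite I"
    and "\<And>i. i \<in> I \<Longrightarrow> f i \<in> carrier M"
  shows "h (\<Oplus>\<^bsub>M\<^esub>i\<in>I. f i) = (\<Oplus>\<^bsub>N\<^esub>i\<in>I. h (f i))"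
proof -
  interpret M: module K M by fact
  interpret N: module K N by fact
  from assms(4,5) show ?thesis
  proof induction
    case empty
    show ?case using linear_map_zero[OF assms(1-3)] by simp
  next
    case (insert j J)
    then have "f \<in> J \<rightarrow> carrier M" "(\<lambda>i. h (f i)) \<in> J \<rightarrow> carrier N" "h (f j) \<in> carrier N"
      using assms(3) by (auto intro: linear_map_closed)
    with insert show ?case
      using assms(3) by (simp add: linear_map_add)
  qed
qed

text \<open>The source of all uniqueness statements below: once a set of generators lies in this
  submodule, the two maps coincide on the whole module.\<close>

lemma linear_map_equalizer:
  assumes "module K M" "module K N" "linear_map K M N g" "linear_map K M N h"
  shows "submodule {x \<in> carrier M. g x = h x} K M"
proof -
  interpret M: module K M by fact
  interpret N: module K N by fact
  have "g (\<ominus>\<^bsub>M\<^esub> x) = h (\<ominus>\<^bsub>M\<^esub> x)" if "x \<in> carrier M" "g x = h x" for x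
    using linear_map_minus[OF assms(1,2,3) M.zero_closed that(1)]
      linear_map_minus[OF assms(1,2,4) M.zero_closed that(1)] that
      linear_map_zero[OF assms(1,2,3)] linear_map_zero[OF assms(1,2,4)]
    by (simp add: a_minus_def)
  then show ?thesis
    using assms(3,4) linear_map_zero[OF assms(1,2,3)] linear_map_zero[OF assms(1,2,4)]
    by (intro M.submoduleI) (auto simp: linear_map_add linear_map_smult)
qed

lemma linear_map_const_zero: "module K N \<Longrightarrow> linear_map K M N (\<lambda>x. \<zero>\<^bsub>N\<^esub>)"
proof -
  assume "module K N"
  then interpret N: module K N .
  show ?thesis by (simp add: linear_map_def)
qed

lemma linear_map_plus:
  assumes "module K N" "linear_map K M N f" "linear_map K M N g"
  shows "linear_map K M N (\<lambda>x. f x \<oplus>\<^bsub>N\<^esub> g x)"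
proof -
  interpret N: module K N by fact
  show ?thesis
    using assms(2,3) by (simp add: linear_map_def N.smult_r_distr N.a_ac)
qed

lemma linear_map_scale:
  assumes "module K N" "linear_map K M N f" "c \<in> carrier K"
  shows "linear_map K M N (\<lambda>x. c \<odot>\<^bsub>N\<^esub> f x)"
proof -
  interpret N: module K N by fact
  show ?thesis
    using assms(2,3) by (simp add: linear_map_def N.smult_r_distr flip: N.smult_assoc1)
      (simp add: N.R.m_comm)
qed

lemma linear_map_sum:
  assumes "module K M" "module K N" "finite I" "\<And>i. i \<in> I \<Longrightarrow> linear_map K M N (f i)"
  shows "linear_map K M N (\<lambda>x. \<Oplus>\<^bsub>N\<^esub>i\<in>I. f i x)"
proof -
  interpret N: module K N by fact
  from assms(3,4) show ?thesis
  proof induction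
    case empty
    show ?case using linear_map_const_zero[OF assms(2)] by simp
  next
    case (insert j J)
    have "linear_map K M N (\<lambda>x. f j x \<oplus>\<^bsub>N\<^esub> (\<Oplus>\<^bsub>N\<^esub>i\<in>J. f i x))"
      using insert by (intro linear_map_plus[OF assms(2)]) auto
    moreover have "(\<Oplus>\<^bsub>N\<^esub>i\<in>insert j J. f i x) = f j x \<oplus>\<^bsub>N\<^esub> (\<Oplus>\<^bsub>N\<^esub>i\<in>J. f i x)"
      if "x \<in> carrier M" for x
      using insert that by (intro N.finsum_insert) (auto intro: linear_map_closed)
    \<comment> \<open>Splitting off the summand \<open>j\<close> is valid only for arguments in
      \<open>carrier M\<close>, so the two functions need not be equal and are exchanged by
      congruence on the carrier.\<close>
    ultimately show ?case
      using linear_map_cong[OF assms(1)] by (smt (verit, best))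
  qed
qed

definition bilinear_map ::
  "('k, 'z) ring_scheme \<Rightarrow> ('k, 'a) module \<Rightarrow> ('k, 'b) module \<Rightarrow> ('k, 'p) module \<Rightarrow>
    ('a \<Rightarrow> 'b \<Rightarrow> 'p) \<Rightarrow> bool" where
  "bilinear_map K M N P \<phi> \<longleftrightarrow>
    (\<forall>n\<in>carrier N. linear_map K M P (\<lambda>m. \<phi> m n)) \<and>
    (\<forall>m\<in>carrier M. linear_map K N P (\<phi> m))"

lemma bilinear_mapI:
  assumes "\<And>n. n \<in> carrier N \<Longrightarrow> linear_map K M P (\<lambda>m. \<phi> m n)"
    and "\<And>m. m \<in> carrier M \<Longrightarrow> linear_map K N P (\<phi> m)"
  shows "bilinear_map K M N P \<phi>"
  using assms by (simp add: bilinear_map_def)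

lemma bilinear_map_left: "\<lbrakk>bilinear_map K M N P \<phi>; n \<in> carrier N\<rbrakk> \<Longrightarrow> linear_map K M P (\<lambda>m. \<phi> m n)"
  and bilinear_map_right: "\<lbrakk>bilinear_map K M N P \<phi>; m \<in> carrier M\<rbrakk> \<Longrightarrow> linear_map K N P (\<phi> m)"
  by (simp_all add: bilinear_map_def)

lemma bilinear_map_closed:
  "\<lbrakk>bilinear_map K M N P \<phi>; m \<in> carrier M; n \<in> carrier N\<rbrakk> \<Longrightarrow> \<phi> m n \<in> carrier P"
  by (auto simp: bilinear_map_def intro: linear_map_closed)

lemma bilinear_map_comp:
  assumes "bilinear_map K M N P \<phi>" "linear_map K M' M f" "linear_map K N' N g" "linear_map K P P' h"
  shows "bilinear_map K M' N' P' (\<lambda>m n. h (\<phi> (f m) (g n)))"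
  using assms by (simp add: bilinear_map_def linear_map_def)

subsection \<open>Direct sums\<close>

lemma abelian_group_direct_sum:
  assumes "\<And>i. i \<in> I \<Longrightarrow> module K (M i)"
  shows "abelian_group (direct_sum K I M)"
proof (rule abelian_groupI)
  have M: "abelian_group (M i)" if "i \<in> I" for i
    using assms[OF that] by (rule module.axioms)
  note cl = abelian_groupE(1,2)[OF M] abelian_group.a_inv_closed[OF M]
  fix u v assume uv: "u \<in> carrier (direct_sum K I M)" "v \<in> carrier (direct_sum K I M)"
  have "{i \<in> I. u i \<oplus>\<^bsub>M i\<^esub> v i \<noteq> \<zero>\<^bsub>M i\<^esub>} \<subseteq> {i \<in> I. u i \<noteq> \<zero>\<^bsub>M i\<^esub>} \<union> {i \<in> I. v i \<noteq> \<zero>\<^bsub>M i\<^esub>}"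
    using abelian_groupE(5)[OF M] cl by auto
  from finite_subset[OF this] uv show "u \<oplus>\<^bsub>direct_sum K I M\<^esub> v \<in> carrier (direct_sum K I M)"
    by (auto simp: direct_sum_def PiE_iff cl cong: conj_cong)
  show "u \<oplus>\<^bsub>direct_sum K I M\<^esub> v = v \<oplus>\<^bsub>direct_sum K I M\<^esub> u"
    using uv abelian_groupE(4)[OF M] by (auto simp: direct_sum_def PiE_iff intro!: restrict_ext)
  show "\<zero>\<^bsub>direct_sum K I M\<^esub> \<oplus>\<^bsub>direct_sum K I M\<^esub> u = u"
    using uv abelian_groupE(5)[OF M]
    by (auto simp: direct_sum_def PiE_iff extensional_def fun_eq_iff restrict_def)
  fix w assume w: "w \<in> carrier (direct_sum K I M)"
  show "u \<oplus>\<^bsub>direct_sum K I M\<^esub> v \<oplus>\<^bsub>direct_sum K I M\<^esub> w = u \<oplus>\<^bsub>direct_sum K I M\<^esub> (v \<oplus>\<^bsub>direct_sum K I M\<^esub> w)"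
    using uv w abelian_groupE(3)[OF M] by (auto simp: direct_sum_def PiE_iff intro!: restrict_ext)
next
  have M: "abelian_group (M i)" if "i \<in> I" for i
    using assms[OF that] by (rule module.axioms)
  note cl = abelian_groupE(1,2)[OF M] abelian_group.a_inv_closed[OF M]
  show "\<zero>\<^bsub>direct_sum K I M\<^esub> \<in> carrier (direct_sum K I M)"
    by (auto simp: direct_sum_def cl)
  fix u assume u: "u \<in> carrier (direct_sum K I M)"
  have "{i \<in> I. \<ominus>\<^bsub>M i\<^esub> u i \<noteq> \<zero>\<^bsub>M i\<^esub>} \<subseteq> {i \<in> I. u i \<noteq> \<zero>\<^bsub>M i\<^esub>}"
    using abelian_group.minus_minus[OF M] abelian_group.minus_equality[OF M] by (auto simp: cl abelian_groupE(5)[OF M])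
  from finite_subset[OF this] u show "\<exists>v\<in>carrier (direct_sum K I M). v \<oplus>\<^bsub>direct_sum K I M\<^esub> u = \<zero>\<^bsub>direct_sum K I M\<^esub>"
    by (intro bexI[of _ "\<lambda>i\<in>I. \<ominus>\<^bsub>M i\<^esub> u i"])
       (auto simp: direct_sum_def PiE_iff cl abelian_group.l_neg[OF M] cong: conj_cong intro!: restrict_ext)
qed

lemma module_direct_sum:
  assumes "cring K" "\<And>i. i \<in> I \<Longrightarrow> module K (M i)"
  shows "module K (direct_sum K I M)"
proof (rule moduleI)
  interpret K: cring K by fact
  have M: "abelian_group (M i)" if "i \<in> I" for i
    using assms(2)[OF that] by (rule module.axioms)
  note cl = abelian_groupE(1,2)[OF M] module.smult_closed[OF assms(2)]
  show "abelian_group (direct_sum K I M)" by (rule abelian_group_direct_sum) fact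
  fix a u assume a: "a \<in> carrier K" and u: "u \<in> carrier (direct_sum K I M)"
  have "{i \<in> I. a \<odot>\<^bsub>M i\<^esub> u i \<noteq> \<zero>\<^bsub>M i\<^esub>} \<subseteq> {i \<in> I. u i \<noteq> \<zero>\<^bsub>M i\<^esub>}"
    using a module.smult_r_null[OF assms(2)] by auto
  from finite_subset[OF this] a u show "a \<odot>\<^bsub>direct_sum K I M\<^esub> u \<in> carrier (direct_sum K I M)"
    by (auto simp: direct_sum_def PiE_iff cl cong: conj_cong)
  { fix b assume "b \<in> carrier K"
    with a u show "(a \<oplus>\<^bsub>K\<^esub> b) \<odot>\<^bsub>direct_sum K I M\<^esub> u =
        a \<odot>\<^bsub>direct_sum K I M\<^esub> u \<oplus>\<^bsub>direct_sum K I M\<^esub> b \<odot>\<^bsub>direct_sum K I M\<^esub> u"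
      "a \<otimes>\<^bsub>K\<^esub> b \<odot>\<^bsub>direct_sum K I M\<^esub> u = a \<odot>\<^bsub>direct_sum K I M\<^esub> (b \<odot>\<^bsub>direct_sum K I M\<^esub> u)"
      using module.smult_l_distr[OF assms(2)] module.smult_assoc1[OF assms(2)]
      by (auto simp: direct_sum_def PiE_iff intro!: restrict_ext) }
  { fix v assume "v \<in> carrier (direct_sum K I M)"
    with a u show "a \<odot>\<^bsub>direct_sum K I M\<^esub> (u \<oplus>\<^bsub>direct_sum K I M\<^esub> v) =
        a \<odot>\<^bsub>direct_sum K I M\<^esub> u \<oplus>\<^bsub>direct_sum K I M\<^esub> a \<odot>\<^bsub>direct_sum K I M\<^esub> v"
      using module.smult_r_distr[OF assms(2)]
      by (auto simp: direct_sum_def PiE_iff intro!: restrict_ext) }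
next
  fix u assume "u \<in> carrier (direct_sum K I M)"
  then show "\<one>\<^bsub>K\<^esub> \<odot>\<^bsub>direct_sum K I M\<^esub> u = u"
    using module.smult_one[OF assms(2)]
    by (auto simp: direct_sum_def PiE_iff extensional_def fun_eq_iff restrict_def)
qed fact

lemma linear_map_single:
  assumes "\<And>i. i \<in> I \<Longrightarrow> module K (M i)" "i \<in> I"
  shows "linear_map K (M i) (direct_sum K I M) (single I M i)"
proof (rule linear_mapI)
  have M: "abelian_group (M i)" if "i \<in> I" for i
    using assms(1)[OF that] by (rule module.axioms)
  note z = abelian_groupE(2,5)[OF M] module.smult_r_null[OF assms(1)]
  fix x assume x: "x \<in> carrier (M i)"
  have "finite {j \<in> I. single I M i x j \<noteq> \<zero>\<^bsub>M j\<^esub>}"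
    by (rule finite_subset[of _ "{i}"]) (auto simp: single_def)
  with x show "single I M i x \<in> carrier (direct_sum K I M)"
    by (auto simp: direct_sum_def single_def z)
  { fix y
    show "single I M i (x \<oplus>\<^bsub>M i\<^esub> y) = single I M i x \<oplus>\<^bsub>direct_sum K I M\<^esub> single I M i y"
      by (auto simp: direct_sum_def single_def z intro!: restrict_ext) }
  { fix c assume "c \<in> carrier K"
    then show "single I M i (c \<odot>\<^bsub>M i\<^esub> x) = c \<odot>\<^bsub>direct_sum K I M\<^esub> single I M i x"
      by (auto simp: direct_sum_def single_def z intro!: restrict_ext) }
qed

lemma linear_map_component:
  "i \<in> I \<Longrightarrow> linear_map K (direct_sum K I M) (M i) (\<lambda>u. u i)"
  by (auto simp: linear_map_def direct_sum_def)

text \<open>An element of finite support is the sum of its entries placed in their components; a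
  submodule containing all of these contains the sum.\<close>

lemma direct_sum_generated:
  assumes "\<And>i. i \<in> I \<Longrightarrow> module K (M i)" "submodule N K (direct_sum K I M)"
    and "\<And>i a. \<lbrakk>i \<in> I; a \<in> carrier (M i)\<rbrakk> \<Longrightarrow> single I M i a \<in> N"
  shows "carrier (direct_sum K I M) \<subseteq> N"
proof
  interpret N: submodule N K "direct_sum K I M" by fact
  have M: "abelian_group (M i)" if "i \<in> I" for i
    using assms(1)[OF that] by (rule module.axioms)
  note z = abelian_groupE(2,5)[OF M] abelian_monoid.r_zero[OF abelian_group.axioms(1)[OF M]]
  \<comment> \<open>The induction runs over any finite set outside which \<open>u\<close> vanishes,
    not over the support itself: clearing one entry then simply removes \<open>j\<close> from that
    set. The set may stick out of \<open>I\<close>, whence the case distinction on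
    \<open>j\<close>.\<close>
  have main: "u \<in> N" if "finite A" "u \<in> carrier (direct_sum K I M)" "\<And>i. \<lbrakk>i \<in> I; i \<notin> A\<rbrakk> \<Longrightarrow> u i = \<zero>\<^bsub>M i\<^esub>" for A u
    using that
  proof (induction A arbitrary: u)
    case empty
    then have "u = \<zero>\<^bsub>direct_sum K I M\<^esub>"
      by (auto simp: direct_sum_def PiE_iff extensional_def fun_eq_iff restrict_def)
    with N.one_closed show ?case by simp
  next
    case (insert j A)
    show ?case
    proof (cases "j \<in> I")
      case False
      with insert show ?thesis by auto
    next
      case True
      let ?v = "u(j := \<zero>\<^bsub>M j\<^esub>)"
      have u: "u \<in> extensional I" "\<And>i. i \<in> I \<Longrightarrow> u i \<in> carrier (M i)" "finite {i \<in> I. u i \<noteq> \<zero>\<^bsub>M i\<^esub>}"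
        using insert.prems by (auto simp: direct_sum_def PiE_iff)
      have "finite {i \<in> I. ?v i \<noteq> \<zero>\<^bsub>M i\<^esub>}"
        by (rule finite_subset[OF _ u(3)]) auto
      then have "?v \<in> carrier (direct_sum K I M)"
        using u True by (auto simp: direct_sum_def PiE_iff z extensional_def)
      then have "?v \<in> N"
        by (rule insert.IH) (use insert.prems in auto)
      \<comment> \<open>The entry at \<open>j\<close> is peeled off; the rest \<open>?v\<close>
        vanishes outside the smaller set.\<close>
      moreover have "u = single I M j (u j) \<oplus>\<^bsub>direct_sum K I M\<^esub> ?v"
        using u True by (auto simp: direct_sum_def single_def z fun_eq_iff extensional_def restrict_def)
      ultimately show ?thesis
        using N.m_closed assms(3)[OF True u(2)[OF True]] by simp metis
    qed
  qed
  fix u assume "u \<in> carrier (direct_sum K I M)"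
  then show "u \<in> N"
    by (intro main[of "{i \<in> I. u i \<noteq> \<zero>\<^bsub>M i\<^esub>}"]) (auto simp: direct_sum_def)
qed

section \<open>Free modules and the linear extension of a map given on the basis\<close>

lemma module_self_module: "cring K \<Longrightarrow> module K (self_module K)"
proof -
  assume "cring K"
  then interpret K: cring K .
  have "abelian_group (self_module K)"
    by (rule abelian_groupI) (auto simp: self_module_def K.a_ac intro: K.l_neg bexI[of _ "\<ominus>\<^bsub>K\<^esub> x" for x])
  then show ?thesis
    by (intro moduleI) (auto simp: self_module_def K.l_distr K.r_distr K.m_assoc K.cring_axioms)
qed

lemma module_free_module: "cring K \<Longrightarrow> module K (free_module K S)"
  by (simp add: free_module_def module_direct_sum module_self_module)

lemma single_eq_smult_basis_elem:
  assumes "cring K" "c \<in> carrier K"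
  shows "single S (\<lambda>_. self_module K) s c = c \<odot>\<^bsub>free_module K S\<^esub> basis_elem K S s"
proof -
  interpret cring K by fact
  show ?thesis
    using assms(2)
    by (auto simp: single_def basis_elem_def free_module_def direct_sum_def self_module_def intro!: restrict_ext)
qed

lemma basis_elem_closed:
  assumes "cring K" "s \<in> S"
  shows "basis_elem K S s \<in> carrier (free_module K S)"
  unfolding basis_elem_def free_module_def
  by (rule linear_map_closed[OF linear_map_single[OF module_self_module[OF assms(1)] assms(2)]])
    (use cring.cring_simprules(6)[OF assms(1)] in \<open>simp add: self_module_def\<close>)

lemma free_module_generated:
  assumes "cring K" "submodule N K (free_module K S)" "\<And>s. s \<in> S \<Longrightarrow> basis_elem K S s \<in> N"
  shows "carrier (free_module K S) \<subseteq> N"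
  unfolding free_module_def
proof (rule direct_sum_generated)
  show "submodule N K (direct_sum K S (\<lambda>_. self_module K))"
    using assms(2) by (simp add: free_module_def)
  fix s c assume "s \<in> S" "c \<in> carrier (self_module K)"
  moreover from this have "c \<in> carrier K" by (simp add: self_module_def)
  ultimately show "single S (\<lambda>_. self_module K) s c \<in> N"
    using assms by (simp add: single_eq_smult_basis_elem submodule.smult_closed)
qed (simp add: module_self_module assms)

lemma free_module_linear_map_eqI:
  assumes "cring K" "module K P" "linear_map K (free_module K S) P g" "linear_map K (free_module K S) P h"
    and "\<And>s. s \<in> S \<Longrightarrow> g (basis_elem K S s) = h (basis_elem K S s)" "v \<in> carrier (free_module K S)"
  shows "g v = h v"
proof -
  have "carrier (free_module K S) \<subseteq> {v \<in> carrier (free_module K S). g v = h v}"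
    by (rule free_module_generated[OF assms(1) linear_map_equalizer[OF module_free_module[OF assms(1)] assms(2-4)]])
      (use assms(1,5) in \<open>simp add: basis_elem_closed\<close>)
  with assms(6) show ?thesis by auto
qed

text \<open>The defining sum runs over the support of \<open>v\<close>, which changes under addition
  and scaling. Any finite set containing the support gives the same sum, so several such sums can be
  compared over one index set.\<close>

lemma linear_ext_eq:
  assumes "cring K" "module K P" "\<And>s. s \<in> S \<Longrightarrow> \<phi> s \<in> carrier P" "v \<in> carrier (free_module K S)"
    and "finite A" "A \<subseteq> S" "\<And>s. \<lbrakk>s \<in> S; s \<notin> A\<rbrakk> \<Longrightarrow> v s = \<zero>\<^bsub>K\<^esub>"
  shows "linear_ext K S P \<phi> v = (\<Oplus>\<^bsub>P\<^esub>s\<in>A. v s \<odot>\<^bsub>P\<^esub> \<phi> s)"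
proof -
  interpret P: module K P by fact
  have "v s \<in> carrier K" if "s \<in> S" for s
    using assms(4) that by (auto simp: free_module_def direct_sum_def self_module_def)
  then show ?thesis
    unfolding linear_ext_def using assms(3,5-7)
    by (intro P.add.finprod_mono_neutral_cong_left) (auto simp: subset_eq)
qed

lemma linear_map_linear_ext:
  assumes "cring K" "module K P" "\<And>s. s \<in> S \<Longrightarrow> \<phi> s \<in> carrier P"
  shows "linear_map K (free_module K S) P (linear_ext K S P \<phi>)"
proof (rule linear_mapI)
  interpret P: module K P by fact
  interpret L: module K "free_module K S" by (rule module_free_module) fact
  let ?supp = "\<lambda>v. {s \<in> S. v s \<noteq> \<zero>\<^bsub>K\<^esub>}"
  have fin: "finite (?supp v)" and co: "s \<in> S \<Longrightarrow> v s \<in> carrier K"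
    if "v \<in> carrier (free_module K S)" for v s
    using that by (auto simp: free_module_def direct_sum_def self_module_def)
  fix u assume u: "u \<in> carrier (free_module K S)"
  show "linear_ext K S P \<phi> u \<in> carrier P"
    unfolding linear_ext_def using co[OF u] assms(3) by (intro P.finsum_closed) auto
  { fix v assume v: "v \<in> carrier (free_module K S)"
    let ?A = "?supp u \<union> ?supp v"
    let ?w = "u \<oplus>\<^bsub>free_module K S\<^esub> v"
    have w: "?w s = u s \<oplus>\<^bsub>K\<^esub> v s" if "s \<in> S" for s
      using that by (simp add: free_module_def direct_sum_def self_module_def)
    have "linear_ext K S P \<phi> ?w = (\<Oplus>\<^bsub>P\<^esub>s\<in>?A. ?w s \<odot>\<^bsub>P\<^esub> \<phi> s)"
      using assms fin[OF u] fin[OF v] u v by (intro linear_ext_eq) (auto simp: w)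
    also have "\<dots> = (\<Oplus>\<^bsub>P\<^esub>s\<in>?A. u s \<odot>\<^bsub>P\<^esub> \<phi> s \<oplus>\<^bsub>P\<^esub> v s \<odot>\<^bsub>P\<^esub> \<phi> s)"
      using co[OF u] co[OF v] assms(3) by (intro P.finsum_cong') (auto simp: w P.smult_l_distr)
    also have "\<dots> = (\<Oplus>\<^bsub>P\<^esub>s\<in>?A. u s \<odot>\<^bsub>P\<^esub> \<phi> s) \<oplus>\<^bsub>P\<^esub> (\<Oplus>\<^bsub>P\<^esub>s\<in>?A. v s \<odot>\<^bsub>P\<^esub> \<phi> s)"
      using co[OF u] co[OF v] assms(3) by (intro P.finsum_addf) auto
    also have "(\<Oplus>\<^bsub>P\<^esub>s\<in>?A. u s \<odot>\<^bsub>P\<^esub> \<phi> s) = linear_ext K S P \<phi> u"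
      using assms fin[OF u] fin[OF v] u by (intro linear_ext_eq[symmetric]) auto
    also have "(\<Oplus>\<^bsub>P\<^esub>s\<in>?A. v s \<odot>\<^bsub>P\<^esub> \<phi> s) = linear_ext K S P \<phi> v"
      using assms fin[OF u] fin[OF v] v by (intro linear_ext_eq[symmetric]) auto
    finally show "linear_ext K S P \<phi> ?w = linear_ext K S P \<phi> u \<oplus>\<^bsub>P\<^esub> linear_ext K S P \<phi> v" . }
  { fix c assume c: "c \<in> carrier K"
    let ?w = "c \<odot>\<^bsub>free_module K S\<^esub> u"
    have w: "?w s = c \<otimes>\<^bsub>K\<^esub> u s" if "s \<in> S" for s
      using that by (simp add: free_module_def direct_sum_def self_module_def)
    have "linear_ext K S P \<phi> ?w = (\<Oplus>\<^bsub>P\<^esub>s\<in>?supp u. ?w s \<odot>\<^bsub>P\<^esub> \<phi> s)"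
      using assms fin[OF u] u c by (intro linear_ext_eq) (auto simp: w)
    also have "\<dots> = (\<Oplus>\<^bsub>P\<^esub>s\<in>?supp u. c \<odot>\<^bsub>P\<^esub> (u s \<odot>\<^bsub>P\<^esub> \<phi> s))"
      using co[OF u] c assms(3) by (intro P.finsum_cong') (auto simp: w P.smult_assoc1)
    also have "\<dots> = c \<odot>\<^bsub>P\<^esub> linear_ext K S P \<phi> u"
      unfolding linear_ext_def using co[OF u] c assms(3) fin[OF u]
      by (intro P.finsum_smult_ldistr[symmetric]) auto
    finally show "linear_ext K S P \<phi> ?w = c \<odot>\<^bsub>P\<^esub> linear_ext K S P \<phi> u" . }
qed

lemma linear_ext_basis_elem:
  assumes "cring K" "module K P" "\<And>s. s \<in> S \<Longrightarrow> \<phi> s \<in> carrier P" "s \<in> S"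
  shows "linear_ext K S P \<phi> (basis_elem K S s) = \<phi> s"
proof -
  interpret P: module K P by fact
  have "linear_ext K S P \<phi> (basis_elem K S s) = (\<Oplus>\<^bsub>P\<^esub>t\<in>{s}. basis_elem K S s t \<odot>\<^bsub>P\<^esub> \<phi> t)"
    using assms
    by (intro linear_ext_eq basis_elem_closed) (auto simp: basis_elem_def single_def self_module_def)
  also have "\<dots> = \<phi> s"
    using assms by (simp add: basis_elem_def single_def self_module_def)
  finally show ?thesis .
qed

subsection \<open>Quotients and presentations\<close>

lemma abelian_subgroup_submodule:
  assumes "module K M" "submodule N K M"
  shows "abelian_subgroup N M"
proof -
  interpret M: module K M by fact
  interpret N: submodule N K M by fact
  show ?thesis
    using N.subgroup_axioms M.abelian_group_axioms
    by (intro abelian_subgroupI3 additive_subgroup.intro)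
qed

text \<open>The product with a scalar is defined as a union of cosets over all representatives,
  since the elementwise multiple of a coset can be too small (for the scalar zero it is a single
  point). All representatives contribute the same coset, and there is at least one, namely
  \<open>x\<close>.\<close>

lemma smult_quotient_module:
  assumes "module K M" "submodule N K M" "c \<in> carrier K" "x \<in> carrier M"
  shows "c \<odot>\<^bsub>quotient_module K M N\<^esub> (N +>\<^bsub>M\<^esub> x) = N +>\<^bsub>M\<^esub> (c \<odot>\<^bsub>M\<^esub> x)"
proof -
  interpret M: module K M by fact
  interpret N: submodule N K M by fact
  interpret S: abelian_subgroup N M by (rule abelian_subgroup_submodule) fact+
  have coset: "N +>\<^bsub>M\<^esub> (c \<odot>\<^bsub>M\<^esub> y) = N +>\<^bsub>M\<^esub> (c \<odot>\<^bsub>M\<^esub> x)" if "y \<in> N +>\<^bsub>M\<^esub> x" for y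
  proof -
    from that obtain n where n: "n \<in> N" "y = n \<oplus>\<^bsub>M\<^esub> x"
      by (auto simp: a_r_coset_def')
    have "c \<odot>\<^bsub>M\<^esub> y \<in> N +>\<^bsub>M\<^esub> (c \<odot>\<^bsub>M\<^esub> x)"
      using n assms by (auto simp: a_r_coset_def' M.smult_r_distr)
    from S.a_repr_independence'[OF this] assms show ?thesis by simp
  qed
  have self: "x \<in> N +>\<^bsub>M\<^esub> x"
    using assms by (intro S.a_rcos_self)
  have "(\<Union>y\<in>N +>\<^bsub>M\<^esub> x. N +>\<^bsub>M\<^esub> (c \<odot>\<^bsub>M\<^esub> y)) = N +>\<^bsub>M\<^esub> (c \<odot>\<^bsub>M\<^esub> x)"
    by (rule SUP_eq_const[OF _ coset]) (use self in blast)
  then show ?thesis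
    by (simp add: quotient_module_def)
qed

lemma module_quotient_module:
  assumes "module K M" "submodule N K M"
  shows "module K (quotient_module K M N)"
proof (rule moduleI)
  interpret M: module K M by fact
  interpret N: submodule N K M by fact
  interpret S: abelian_subgroup N M by (rule abelian_subgroup_submodule) fact+
  let ?Q = "quotient_module K M N"
  have add: "(N +>\<^bsub>M\<^esub> x) \<oplus>\<^bsub>?Q\<^esub> (N +>\<^bsub>M\<^esub> y) = N +>\<^bsub>M\<^esub> (x \<oplus>\<^bsub>M\<^esub> y)"
    if "x \<in> carrier M" "y \<in> carrier M" for x y
    using that by (simp add: quotient_module_def S.a_rcos_sum)
  note sm = smult_quotient_module[OF assms]
  have car: "carrier ?Q = (\<lambda>x. N +>\<^bsub>M\<^esub> x) ` carrier M"
    by (auto simp: quotient_module_def A_RCOSETS_def')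
  have zero: "\<zero>\<^bsub>?Q\<^esub> = N +>\<^bsub>M\<^esub> \<zero>\<^bsub>M\<^esub>"
    by (simp add: quotient_module_def S.a_subset)
  show "cring K" by (rule M.R.cring_axioms)
  show "abelian_group ?Q"
  proof (rule abelian_groupI)
    fix U assume "U \<in> carrier ?Q"
    then obtain x where x: "x \<in> carrier M" "U = N +>\<^bsub>M\<^esub> x" by (auto simp: car)
    have "(N +>\<^bsub>M\<^esub> (\<ominus>\<^bsub>M\<^esub> x)) \<oplus>\<^bsub>?Q\<^esub> U = \<zero>\<^bsub>?Q\<^esub>"
      using x by (simp add: add zero M.l_neg)
    then show "\<exists>V\<in>carrier ?Q. V \<oplus>\<^bsub>?Q\<^esub> U = \<zero>\<^bsub>?Q\<^esub>"
      using x by (auto simp: car)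
  qed (auto simp: car add zero M.a_ac)
  fix U assume "U \<in> carrier ?Q"
  then obtain x where x: "x \<in> carrier M" "U = N +>\<^bsub>M\<^esub> x" by (auto simp: car)
  then show "\<one>\<^bsub>K\<^esub> \<odot>\<^bsub>?Q\<^esub> U = U"
    by (simp add: sm)
  fix a assume a: "a \<in> carrier K"
  with x show "a \<odot>\<^bsub>?Q\<^esub> U \<in> carrier ?Q"
    by (auto simp: car sm)
  { fix b assume "b \<in> carrier K"
    with a x show "(a \<oplus>\<^bsub>K\<^esub> b) \<odot>\<^bsub>?Q\<^esub> U = a \<odot>\<^bsub>?Q\<^esub> U \<oplus>\<^bsub>?Q\<^esub> b \<odot>\<^bsub>?Q\<^esub> U"
      "a \<otimes>\<^bsub>K\<^esub> b \<odot>\<^bsub>?Q\<^esub> U = a \<odot>\<^bsub>?Q\<^esub> (b \<odot>\<^bsub>?Q\<^esub> U)"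
      by (auto simp: sm add M.smult_l_distr M.smult_assoc1) }
  { fix V assume "V \<in> carrier ?Q"
    with a x show "a \<odot>\<^bsub>?Q\<^esub> (U \<oplus>\<^bsub>?Q\<^esub> V) = a \<odot>\<^bsub>?Q\<^esub> U \<oplus>\<^bsub>?Q\<^esub> a \<odot>\<^bsub>?Q\<^esub> V"
      by (auto simp: car sm add M.smult_r_distr) }
qed

lemma linear_map_quotient_proj:
  assumes "module K M" "submodule N K M"
  shows "linear_map K M (quotient_module K M N) (\<lambda>x. N +>\<^bsub>M\<^esub> x)"
proof (rule linear_mapI)
  interpret S: abelian_subgroup N M by (rule abelian_subgroup_submodule) fact+
  fix x assume x: "x \<in> carrier M"
  then show "N +>\<^bsub>M\<^esub> x \<in> carrier (quotient_module K M N)"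
    by (auto simp: quotient_module_def A_RCOSETS_def')
  show "N +>\<^bsub>M\<^esub> (x \<oplus>\<^bsub>M\<^esub> y) = (N +>\<^bsub>M\<^esub> x) \<oplus>\<^bsub>quotient_module K M N\<^esub> (N +>\<^bsub>M\<^esub> y)" if "y \<in> carrier M" for y
    using x that by (simp add: quotient_module_def S.a_rcos_sum)
qed (simp add: smult_quotient_module assms)

lemma quotient_module_cases:
  assumes "U \<in> carrier (quotient_module K M N)"
  obtains x where "x \<in> carrier M" "U = N +>\<^bsub>M\<^esub> x"
  using assms by (auto simp: quotient_module_def A_RCOSETS_def')

lemma submodule_module_span:
  assumes "module K M" "G \<subseteq> carrier M"
  shows "submodule (module_span K M G) K M"
proof -
  interpret M: module K M by fact
  note E = M.submoduleE
  have zero: "\<zero>\<^bsub>M\<^esub> \<in> N" if "submodule N K M" for N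
    using subgroup.one_closed[OF submodule.axioms(1)[OF that]] by simp
  \<comment> \<open>The intersection defining the span must range over a nonempty family: otherwise
    it would be the whole type and not a subset of the carrier.\<close>
  have "\<exists>N. submodule N K M \<and> G \<subseteq> N"
    using M.carrier_is_submodule assms by blast
  then show ?thesis
    unfolding module_span_def using E(1)
    by (intro M.submoduleI) (auto intro: zero E(3-5))
qed

lemma module_span_superset: "G \<subseteq> module_span K M G"
  by (auto simp: module_span_def)

lemma module_span_least: "\<lbrakk>submodule N K M; G \<subseteq> N\<rbrakk> \<Longrightarrow> module_span K M G \<subseteq> N"
  by (auto simp: module_span_def)

text \<open>Pulls a submodule of a quotient back to the free module, where generation by the basis
  is already known.\<close>

lemma submodule_preimage:
  assumes "module K M" "module K N" "linear_map K M N h" "submodule H K N"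
  shows "submodule {x \<in> carrier M. h x \<in> H} K M"
proof -
  interpret M: module K M by fact
  interpret N: module K N by fact
  note E = N.submoduleE[OF assms(4)]
  have "\<zero>\<^bsub>N\<^esub> \<in> H"
    using subgroup.one_closed[OF submodule.axioms(1)[OF assms(4)]] by simp
  moreover have "h (\<ominus>\<^bsub>M\<^esub> x) = \<ominus>\<^bsub>N\<^esub> h x" if "x \<in> carrier M" for x
    using linear_map_minus[OF assms(1-3) M.zero_closed that] linear_map_zero[OF assms(1-3)]
      linear_map_closed[OF assms(3) that] that
    by (simp add: a_minus_def)
  ultimately show ?thesis
    using E(3-5) by (intro M.submoduleI)
      (auto simp: linear_map_add[OF assms(3)] linear_map_smult[OF assms(3)] linear_map_zero[OF assms(1-3)])
qed

text \<open>Tensor products of two modules and of a family differ only in generators and relations.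
  What both need of the module generated by \<open>S\<close> subject to \<open>G\<close> is proved
  once here.\<close>

locale presentation =
  fixes K :: "('k, 'z) ring_scheme" and S :: "'s set" and G :: "('s \<Rightarrow> 'k) set"
  assumes cring: "cring K" and relations: "G \<subseteq> carrier (free_module K S)"
begin

abbreviation "null \<equiv> module_span K (free_module K S) G"
abbreviation "Q \<equiv> quotient_module K (free_module K S) null"
abbreviation "gen s \<equiv> null +>\<^bsub>free_module K S\<^esub> basis_elem K S s"

lemmas module_L = module_free_module[OF cring, of S]

lemma submodule_null: "submodule null K (free_module K S)"
  by (rule submodule_module_span[OF module_L relations])

lemmas module_Q = module_quotient_module[OF module_L submodule_null]

lemmas proj = linear_map_quotient_proj[OF module_L submodule_null]

lemma gen_closed: "s \<in> S \<Longrightarrow> gen s \<in> carrier Q"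
  by (rule linear_map_closed[OF proj]) (rule basis_elem_closed[OF cring])

lemma generated:
  assumes "submodule P K Q" "\<And>s. s \<in> S \<Longrightarrow> gen s \<in> P"
  shows "carrier Q \<subseteq> P"
proof
  have "submodule {v \<in> carrier (free_module K S). null +>\<^bsub>free_module K S\<^esub> v \<in> P} K (free_module K S)"
    by (rule submodule_preimage[OF module_L module_Q proj assms(1)])
  from free_module_generated[OF cring this]
  have *: "null +>\<^bsub>free_module K S\<^esub> v \<in> P" if "v \<in> carrier (free_module K S)" for v
    using that assms(2) by (auto simp: basis_elem_closed[OF cring])
  fix U assume "U \<in> carrier Q"
  then show "U \<in> P" by (rule quotient_module_cases) (simp add: *)
qed

lemma linear_map_eqI:
  assumes "module K P" "linear_map K Q P g" "linear_map K Q P h"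
    and "\<And>s. s \<in> S \<Longrightarrow> g (gen s) = h (gen s)" "u \<in> carrier Q"
  shows "g u = h u"
proof -
  have "carrier Q \<subseteq> {u \<in> carrier Q. g u = h u}"
    by (rule generated[OF linear_map_equalizer[OF module_Q assms(1-3)]]) (simp add: gen_closed assms(4))
  with assms(5) show ?thesis by blast
qed

lemma proj_relation:
  assumes "g \<in> G"
  shows "null +>\<^bsub>free_module K S\<^esub> g = \<zero>\<^bsub>Q\<^esub>"
proof -
  have "g \<in> null" "g \<in> carrier (free_module K S)"
    using subsetD[OF module_span_superset assms] subsetD[OF relations assms] .
  then have "null +>\<^bsub>free_module K S\<^esub> g = null"
    using abelian_group.a_coset_join2[OF module.axioms(2)[OF module_L] _ submodule.axioms(1)[OF submodule_null]]
    by simp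
  then show ?thesis by (simp add: quotient_module_def)
qed

text \<open>The relations are written as differences of the two sides of an identity; this turns
  membership of such a difference in \<open>G\<close> into the identity between classes.\<close>

lemma proj_eqI:
  assumes "v \<in> carrier (free_module K S)" "w \<in> carrier (free_module K S)" "v \<ominus>\<^bsub>free_module K S\<^esub> w \<in> G"
  shows "null +>\<^bsub>free_module K S\<^esub> v = null +>\<^bsub>free_module K S\<^esub> w"
proof -
  interpret Q: module K Q by (rule module_Q)
  let ?v = "null +>\<^bsub>free_module K S\<^esub> v" and ?w = "null +>\<^bsub>free_module K S\<^esub> w"
  note vw = linear_map_closed[OF proj assms(1)] linear_map_closed[OF proj assms(2)]
  have "?v \<ominus>\<^bsub>Q\<^esub> ?w = \<zero>\<^bsub>Q\<^esub>"
    by (simp only: linear_map_minus[OF module_L module_Q proj assms(1,2), symmetric] proj_relation[OF assms(3)])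
  moreover have "?v = (?v \<ominus>\<^bsub>Q\<^esub> ?w) \<oplus>\<^bsub>Q\<^esub> ?w"
    using vw by (simp only: a_minus_def Q.M.a_assoc Q.M.a_inv_closed Q.M.l_neg Q.M.r_zero)
  ultimately show ?thesis
    using vw(2) by (simp only: Q.M.l_zero)
qed

context
  fixes P :: "('k, 'p) module" and \<phi> :: "'s \<Rightarrow> 'p"
  assumes P: "module K P" and \<phi>: "\<And>s. s \<in> S \<Longrightarrow> \<phi> s \<in> carrier P"
    and respects: "\<And>g. g \<in> G \<Longrightarrow> linear_ext K S P \<phi> g = \<zero>\<^bsub>P\<^esub>"
begin

text \<open>The kernel of \<open>linear_ext\<close> is a submodule containing \<open>G\<close>,
  hence it contains the span \<open>null\<close>. So \<open>linear_ext\<close> is constant on each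
  coset, and since \<open>null\<close> is not empty, its image there is a singleton:
  \<open>the_elem\<close> is well defined.\<close>

lemma class_lift_proj:
  assumes "v \<in> carrier (free_module K S)"
  shows "class_lift K S P \<phi> (null +>\<^bsub>free_module K S\<^esub> v) = linear_ext K S P \<phi> v"
proof -
  interpret P: module K P by (rule P)
  note ext = linear_map_linear_ext[OF cring P \<phi>]
  have "null \<subseteq> {v \<in> carrier (free_module K S). linear_ext K S P \<phi> v = \<zero>\<^bsub>P\<^esub>}"
    by (rule module_span_least[OF linear_map_equalizer[OF module_L P ext linear_map_const_zero[OF P]]])
      (use relations respects in auto)
  then have "linear_ext K S P \<phi> (n \<oplus>\<^bsub>free_module K S\<^esub> v) = linear_ext K S P \<phi> v" if "n \<in> null" for n
    using that assms linear_map_closed[OF ext assms] by (subst linear_map_add[OF ext]) auto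
  moreover have "null \<noteq> {}"
    by (rule module.submoduleE(2)[OF module_L submodule_null])
  ultimately have "linear_ext K S P \<phi> ` (null +>\<^bsub>free_module K S\<^esub> v) = {linear_ext K S P \<phi> v}"
    unfolding a_r_coset_def' image_UN by auto
  then show ?thesis by (simp add: class_lift_def)
qed

lemma class_lift_gen: "s \<in> S \<Longrightarrow> class_lift K S P \<phi> (gen s) = \<phi> s"
  by (simp add: class_lift_proj basis_elem_closed[OF cring] linear_ext_basis_elem[OF cring P \<phi>])

lemma linear_map_class_lift: "linear_map K Q P (class_lift K S P \<phi>)"
proof (rule linear_mapI)
  note ext = linear_map_linear_ext[OF cring P \<phi>]
  fix U assume "U \<in> carrier Q"
  then obtain u where u: "u \<in> carrier (free_module K S)" "U = null +>\<^bsub>free_module K S\<^esub> u"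
    by (rule quotient_module_cases)
  with linear_map_closed[OF ext] show "class_lift K S P \<phi> U \<in> carrier P"
    by (simp add: class_lift_proj)
  { fix V assume "V \<in> carrier Q"
    then obtain v where v: "v \<in> carrier (free_module K S)" "V = null +>\<^bsub>free_module K S\<^esub> v"
      by (rule quotient_module_cases)
    with u show "class_lift K S P \<phi> (U \<oplus>\<^bsub>Q\<^esub> V) = class_lift K S P \<phi> U \<oplus>\<^bsub>P\<^esub> class_lift K S P \<phi> V"
      by (simp add: linear_map_add[OF proj, symmetric] abelian_groupE(1)[OF module.axioms(2)[OF module_L]] class_lift_proj linear_map_add[OF ext]) }
  { fix c assume "c \<in> carrier K"
    with u show "class_lift K S P \<phi> (c \<odot>\<^bsub>Q\<^esub> U) = c \<odot>\<^bsub>P\<^esub> class_lift K S P \<phi> U"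
      by (simp add: linear_map_smult[OF proj, symmetric] module.smult_closed[OF module_L] class_lift_proj linear_map_smult[OF ext]) }
qed

end

end

subsection \<open>Binary tensor products\<close>

lemma tensor_relationsI:
  fixes K (structure) and M (structure) and N (structure)
  defines "L \<equiv> free_module K (carrier M \<times> carrier N)" and "e \<equiv> basis_elem K (carrier M \<times> carrier N)"
  shows "\<lbrakk>m \<in> carrier M; m' \<in> carrier M; n \<in> carrier N\<rbrakk> \<Longrightarrow>
      e (m \<oplus>\<^bsub>M\<^esub> m', n) \<ominus>\<^bsub>L\<^esub> (e (m, n) \<oplus>\<^bsub>L\<^esub> e (m', n)) \<in> tensor_relations K M N"
    and "\<lbrakk>m \<in> carrier M; n \<in> carrier N; n' \<in> carrier N\<rbrakk> \<Longrightarrow>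
      e (m, n \<oplus>\<^bsub>N\<^esub> n') \<ominus>\<^bsub>L\<^esub> (e (m, n) \<oplus>\<^bsub>L\<^esub> e (m, n')) \<in> tensor_relations K M N"
    and "\<lbrakk>c \<in> carrier K; m \<in> carrier M; n \<in> carrier N\<rbrakk> \<Longrightarrow>
      e (c \<odot>\<^bsub>M\<^esub> m, n) \<ominus>\<^bsub>L\<^esub> (c \<odot>\<^bsub>L\<^esub> e (m, n)) \<in> tensor_relations K M N"
    and "\<lbrakk>c \<in> carrier K; m \<in> carrier M; n \<in> carrier N\<rbrakk> \<Longrightarrow>
      e (m, c \<odot>\<^bsub>N\<^esub> n) \<ominus>\<^bsub>L\<^esub> (c \<odot>\<^bsub>L\<^esub> e (m, n)) \<in> tensor_relations K M N"
  unfolding tensor_relations_def Let_def L_def e_def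
  subgoal by (rule UnI1, rule UnI1, rule UnI1, rule CollectI, rule exI[of _ m], rule exI[of _ m'], rule exI[of _ n]) simp
  subgoal by (rule UnI1, rule UnI1, rule UnI2, rule CollectI, rule exI[of _ m], rule exI[of _ n], rule exI[of _ n']) simp
  subgoal by (rule UnI1, rule UnI2, rule CollectI, rule exI[of _ c], rule exI[of _ m], rule exI[of _ n]) simp
  subgoal by (rule UnI2, rule CollectI, rule exI[of _ c], rule exI[of _ m], rule exI[of _ n]) simp
  done

context
  fixes K :: "('k, 'z) ring_scheme" and M :: "('k, 'a) module" and N :: "('k, 'b) module"
  assumes M: "module K M" and N: "module K N"
begin

interpretation M: module K M by (rule M)
interpretation N: module K N by (rule N)

lemma presentation_tensor: "presentation K (carrier M \<times> carrier N) (tensor_relations K M N)"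
proof (rule presentation.intro)
  show "cring K" by (rule M.R.cring_axioms)
  interpret L: module K "free_module K (carrier M \<times> carrier N)"
    by (rule module_free_module) (rule M.R.cring_axioms)
  note e = basis_elem_closed[OF M.R.cring_axioms]
  show "tensor_relations K M N \<subseteq> carrier (free_module K (carrier M \<times> carrier N))"
    unfolding tensor_relations_def Let_def
    by (intro Un_least subsetI; elim CollectE exE conjE) (simp_all add: e)
qed

interpretation T: presentation K "carrier M \<times> carrier N" "tensor_relations K M N"
  by (rule presentation_tensor)

lemma tensor_eq_Q: "tensor K M N = T.Q"
  by (simp add: tensor_def tensor_null_def)

lemma pure_tensor_eq_gen: "pure_tensor K M N m n = T.gen (m, n)"
  by (simp add: pure_tensor_def tensor_null_def)

lemma module_tensor: "module K (tensor K M N)"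
  unfolding tensor_eq_Q by (rule T.module_Q)

text \<open>Modulo the span of the relations, the four families of relations are precisely
  additivity and homogeneity in each argument.\<close>

lemma bilinear_map_pure_tensor: "bilinear_map K M N (tensor K M N) (pure_tensor K M N)"
proof -
  interpret L: module K "free_module K (carrier M \<times> carrier N)"
    by (rule T.module_L)
  let ?L = "free_module K (carrier M \<times> carrier N)"
  let ?e = "basis_elem K (carrier M \<times> carrier N)"
  note e = basis_elem_closed[OF M.R.cring_axioms]
  have rel: "T.gen s = T.null +>\<^bsub>?L\<^esub> w"
    if "s \<in> carrier M \<times> carrier N" "w \<in> carrier ?L" "?e s \<ominus>\<^bsub>?L\<^esub> w \<in> tensor_relations K M N" for s w
    using that by (intro T.proj_eqI e)
  show ?thesis
    unfolding tensor_eq_Q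
  proof (intro bilinear_mapI linear_mapI; unfold pure_tensor_eq_gen)
    fix m n assume mn: "m \<in> carrier M" "n \<in> carrier N"
    \<comment> \<open>Stated twice because closedness arises as a goal for each of the two arguments
      of the bilinear map.\<close>
    then show "T.gen (m, n) \<in> carrier T.Q" "T.gen (m, n) \<in> carrier T.Q"
      by (simp_all add: T.gen_closed)
    { fix m' assume m': "m' \<in> carrier M"
      then have "T.gen (m \<oplus>\<^bsub>M\<^esub> m', n) = T.null +>\<^bsub>?L\<^esub> (?e (m, n) \<oplus>\<^bsub>?L\<^esub> ?e (m', n))"
        using mn by (intro rel tensor_relationsI) (simp_all add: e)
      then show "T.gen (m \<oplus>\<^bsub>M\<^esub> m', n) = T.gen (m, n) \<oplus>\<^bsub>T.Q\<^esub> T.gen (m', n)"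
        using mn m' by (simp add: e linear_map_add[OF T.proj]) }
    { fix n' assume n': "n' \<in> carrier N"
      then have "T.gen (m, n \<oplus>\<^bsub>N\<^esub> n') = T.null +>\<^bsub>?L\<^esub> (?e (m, n) \<oplus>\<^bsub>?L\<^esub> ?e (m, n'))"
        using mn by (intro rel tensor_relationsI) (simp_all add: e)
      then show "T.gen (m, n \<oplus>\<^bsub>N\<^esub> n') = T.gen (m, n) \<oplus>\<^bsub>T.Q\<^esub> T.gen (m, n')"
        using mn n' by (simp add: e linear_map_add[OF T.proj]) }
    { fix c assume c: "c \<in> carrier K"
      then have "T.gen (c \<odot>\<^bsub>M\<^esub> m, n) = T.null +>\<^bsub>?L\<^esub> (c \<odot>\<^bsub>?L\<^esub> ?e (m, n))"
        using mn by (intro rel tensor_relationsI) (simp_all add: e)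
      then show "T.gen (c \<odot>\<^bsub>M\<^esub> m, n) = c \<odot>\<^bsub>T.Q\<^esub> T.gen (m, n)"
        using mn c by (simp add: e linear_map_smult[OF T.proj])
      have "T.gen (m, c \<odot>\<^bsub>N\<^esub> n) = T.null +>\<^bsub>?L\<^esub> (c \<odot>\<^bsub>?L\<^esub> ?e (m, n))"
        using mn c by (intro rel tensor_relationsI) (simp_all add: e)
      then show "T.gen (m, c \<odot>\<^bsub>N\<^esub> n) = c \<odot>\<^bsub>T.Q\<^esub> T.gen (m, n)"
        using mn c by (simp add: e linear_map_smult[OF T.proj]) }
  qed
qed

lemmas pure_tensor_closed = bilinear_map_closed[OF bilinear_map_pure_tensor]

lemma tensor_linear_map_eqI:
  assumes "module K P" "linear_map K (tensor K M N) P g" "linear_map K (tensor K M N) P h"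
    and "\<And>m n. \<lbrakk>m \<in> carrier M; n \<in> carrier N\<rbrakk> \<Longrightarrow> g (pure_tensor K M N m n) = h (pure_tensor K M N m n)"
    and "u \<in> carrier (tensor K M N)"
  shows "g u = h u"
proof (rule T.linear_map_eqI[OF assms(1) assms(2,3)[unfolded tensor_eq_Q] _ assms(5)[unfolded tensor_eq_Q]])
  show "g (T.gen s) = h (T.gen s)" if "s \<in> carrier M \<times> carrier N" for s
    using that assms(4)[unfolded pure_tensor_eq_gen, of "fst s" "snd s"] by (simp add: mem_Times_iff)
qed

text \<open>Existence half of the universal property: bilinearity says that the linear extension
  kills every relation. With the uniqueness half \<open>tensor_linear_map_eqI\<close>, binary tensor
  products can be handled from here on without looking at cosets.\<close>

lemma tensor_lift:
  assumes P: "module K P" and \<phi>: "bilinear_map K M N P \<phi>"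
  shows linear_map_tensor_lift: "linear_map K (tensor K M N) P (tensor_lift K M N P \<phi>)"
    and tensor_lift_pure_tensor: "\<And>m n. \<lbrakk>m \<in> carrier M; n \<in> carrier N\<rbrakk> \<Longrightarrow>
      tensor_lift K M N P \<phi> (pure_tensor K M N m n) = \<phi> m n"
proof -
  interpret P: module K P by (rule P)
  let ?L = "free_module K (carrier M \<times> carrier N)"
  let ?e = "basis_elem K (carrier M \<times> carrier N)"
  let ?\<psi> = "\<lambda>(m, n). \<phi> m n"
  interpret L: module K ?L by (rule T.module_L)
  have cl: "?\<psi> s \<in> carrier P" if "s \<in> carrier M \<times> carrier N" for s
    using that by (auto simp: bilinear_map_closed[OF \<phi>])
  note e = basis_elem_closed[OF M.R.cring_axioms]
  note ext = linear_map_linear_ext[where \<phi> = ?\<psi>, OF M.R.cring_axioms P cl]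
    linear_ext_basis_elem[where \<phi> = ?\<psi>, OF M.R.cring_axioms P cl]
  note [simp] = ext(2) e linear_map_minus[OF T.module_L P ext(1)] linear_map_add[OF ext(1)] linear_map_smult[OF ext(1)]
    bilinear_map_closed[OF \<phi>] linear_map_add[OF bilinear_map_left[OF \<phi>]] linear_map_add[OF bilinear_map_right[OF \<phi>]]
    linear_map_smult[OF bilinear_map_left[OF \<phi>]] linear_map_smult[OF bilinear_map_right[OF \<phi>]]
  have [simp]: "x \<ominus>\<^bsub>P\<^esub> x = \<zero>\<^bsub>P\<^esub>" if "x \<in> carrier P" for x
    using that by (simp add: a_minus_def P.M.r_neg)
  have resp: "linear_ext K (carrier M \<times> carrier N) P ?\<psi> g = \<zero>\<^bsub>P\<^esub>" if "g \<in> tensor_relations K M N" for g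
    using that unfolding tensor_relations_def Let_def
    by (elim UnE CollectE exE conjE) simp_all
  show "linear_map K (tensor K M N) P (tensor_lift K M N P \<phi>)"
    unfolding tensor_lift_def tensor_eq_Q by (rule T.linear_map_class_lift[OF P cl resp])
  show "tensor_lift K M N P \<phi> (pure_tensor K M N m n) = \<phi> m n"
    if "m \<in> carrier M" "n \<in> carrier N" for m n
    unfolding tensor_lift_def pure_tensor_eq_gen using that by (simp add: T.class_lift_gen[OF P cl resp])
qed

end

lemma bilinear_map_flip: "bilinear_map K M N P \<phi> \<Longrightarrow> bilinear_map K N M P (\<lambda>n m. \<phi> m n)"
  by (simp add: bilinear_map_def)

text \<open>Needed for the rebracketing maps, which are nested lifts: the outer lift requires the
  inner one to be linear in its parameter \<open>p\<close> as well. For fixed \<open>p\<close>,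
  \<open>q\<close> or \<open>c\<close> both sides of such an identity are linear in
  \<open>u\<close>, so it can be checked on pure tensors.\<close>

lemma linear_map_tensor_lift_param:
  assumes "module K M" "module K N" "module K P" "module K Q"
    and \<phi>: "\<And>p. p \<in> carrier P \<Longrightarrow> bilinear_map K M N Q (\<lambda>m n. \<phi> m n p)"
    and lin: "\<And>m n. \<lbrakk>m \<in> carrier M; n \<in> carrier N\<rbrakk> \<Longrightarrow> linear_map K P Q (\<phi> m n)"
  shows "bilinear_map K (tensor K M N) P Q (\<lambda>u p. tensor_lift K M N Q (\<lambda>m n. \<phi> m n p) u)"
proof (intro bilinear_mapI linear_mapI[where M = P])
  interpret P: module K P by fact
  note lift = linear_map_tensor_lift[OF assms(1,2,4) \<phi>] and pure = tensor_lift_pure_tensor[OF assms(1,2,4) \<phi>]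
  show "linear_map K (tensor K M N) Q (\<lambda>u. tensor_lift K M N Q (\<lambda>m n. \<phi> m n p) u)" if "p \<in> carrier P" for p
    using that by (rule lift)
  fix u assume u: "u \<in> carrier (tensor K M N)"
  fix p assume p: "p \<in> carrier P"
  show "tensor_lift K M N Q (\<lambda>m n. \<phi> m n p) u \<in> carrier Q"
    using lift[OF p] u by (rule linear_map_closed)
  show "tensor_lift K M N Q (\<lambda>m n. \<phi> m n (p \<oplus>\<^bsub>P\<^esub> q)) u =
      tensor_lift K M N Q (\<lambda>m n. \<phi> m n p) u \<oplus>\<^bsub>Q\<^esub> tensor_lift K M N Q (\<lambda>m n. \<phi> m n q) u"
    if q: "q \<in> carrier P" for q
  proof (rule tensor_linear_map_eqI[OF assms(1,2,4) lift linear_map_plus[OF assms(4) lift lift] _ u])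
    show "p \<oplus>\<^bsub>P\<^esub> q \<in> carrier P" "p \<in> carrier P" "q \<in> carrier P" using p q by auto
  qed (use p q in \<open>simp add: pure linear_map_add[OF lin]\<close>)
  show "tensor_lift K M N Q (\<lambda>m n. \<phi> m n (c \<odot>\<^bsub>P\<^esub> p)) u = c \<odot>\<^bsub>Q\<^esub> tensor_lift K M N Q (\<lambda>m n. \<phi> m n p) u"
    if c: "c \<in> carrier K" for c
  proof (rule tensor_linear_map_eqI[OF assms(1,2,4) lift linear_map_scale[OF assms(4) lift c] _ u])
    show "c \<odot>\<^bsub>P\<^esub> p \<in> carrier P" "p \<in> carrier P" using p c by auto
  qed (use p c in \<open>simp add: pure linear_map_smult[OF lin]\<close>)
qed

lemma tensor_map:
  assumes "module K M" "module K N" "module K M'" "module K N'"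
    and f: "linear_map K M M' f" and g: "linear_map K N N' g"
  shows linear_map_tensor_map: "linear_map K (tensor K M N) (tensor K M' N') (tensor_map K M N M' N' f g)"
    and tensor_map_pure_tensor: "\<And>m n. \<lbrakk>m \<in> carrier M; n \<in> carrier N\<rbrakk> \<Longrightarrow>
      tensor_map K M N M' N' f g (pure_tensor K M N m n) = pure_tensor K M' N' (f m) (g n)"
  unfolding tensor_map_def
  by (rule linear_map_tensor_lift tensor_lift_pure_tensor module_tensor assms
      bilinear_map_comp[OF bilinear_map_pure_tensor f g linear_map_id] | assumption)+

lemma tensor_assoc:
  assumes "module K M" "module K N" "module K P"
  shows linear_map_tensor_assoc:
      "linear_map K (tensor K (tensor K M N) P) (tensor K M (tensor K N P)) (tensor_assoc K M N P)"
    and tensor_assoc_pure_tensor: "\<And>m n p. \<lbrakk>m \<in> carrier M; n \<in> carrier N; p \<in> carrier P\<rbrakk> \<Longrightarrow>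
      tensor_assoc K M N P (pure_tensor K (tensor K M N) P (pure_tensor K M N m n) p) =
      pure_tensor K M (tensor K N P) m (pure_tensor K N P n p)"
proof -
  let ?Q = "tensor K M (tensor K N P)"
  let ?\<phi> = "\<lambda>m n p. pure_tensor K M (tensor K N P) m (pure_tensor K N P n p)"
  note mod = assms module_tensor[OF assms(1,2)] module_tensor[OF assms(2,3)]
    module_tensor[OF assms(1) module_tensor[OF assms(2,3)]]
  note b1 = bilinear_map_pure_tensor[OF assms(2,3)]
    and b2 = bilinear_map_pure_tensor[OF assms(1) module_tensor[OF assms(2,3)]]
  have 1: "bilinear_map K M N ?Q (\<lambda>m n. ?\<phi> m n p)" if "p \<in> carrier P" for p
    by (rule bilinear_map_comp[OF b2 linear_map_id bilinear_map_left[OF b1 that] linear_map_id])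
  have 2: "linear_map K P ?Q (?\<phi> m n)" if "m \<in> carrier M" "n \<in> carrier N" for m n
    by (rule linear_map_comp[OF bilinear_map_right[OF b1 that(2)] bilinear_map_right[OF b2 that(1)]])
  note 3 = linear_map_tensor_lift_param[where \<phi> = ?\<phi>, OF assms mod(6) 1 2]
  show "linear_map K (tensor K (tensor K M N) P) ?Q (tensor_assoc K M N P)"
    unfolding tensor_assoc_def by (rule linear_map_tensor_lift[OF mod(4,3,6) 3])
  show "tensor_assoc K M N P (pure_tensor K (tensor K M N) P (pure_tensor K M N m n) p) = ?\<phi> m n p"
    if "m \<in> carrier M" "n \<in> carrier N" "p \<in> carrier P" for m n p
    unfolding tensor_assoc_def
    by (simp only: tensor_lift_pure_tensor[OF mod(4,3,6) 3] that pure_tensor_closed[OF assms(1,2)]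
        tensor_lift_pure_tensor[where \<phi> = "\<lambda>m n. ?\<phi> m n p", OF assms(1,2) mod(6) 1])
qed

lemma tensor_assoc_inv:
  assumes "module K M" "module K N" "module K P"
  shows linear_map_tensor_assoc_inv:
      "linear_map K (tensor K M (tensor K N P)) (tensor K (tensor K M N) P) (tensor_assoc_inv K M N P)"
    and tensor_assoc_inv_pure_tensor: "\<And>m n p. \<lbrakk>m \<in> carrier M; n \<in> carrier N; p \<in> carrier P\<rbrakk> \<Longrightarrow>
      tensor_assoc_inv K M N P (pure_tensor K M (tensor K N P) m (pure_tensor K N P n p)) =
      pure_tensor K (tensor K M N) P (pure_tensor K M N m n) p"
proof -
  let ?Q = "tensor K (tensor K M N) P"
  \<comment> \<open>Here the parameter of the inner lift is the left factor \<open>m\<close>. It is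
    put last to fit \<open>linear_map_tensor_lift_param\<close>, and
    \<open>bilinear_map_flip\<close> then restores the order.\<close>
  let ?\<phi> = "\<lambda>n p m. pure_tensor K (tensor K M N) P (pure_tensor K M N m n) p"
  note mod = assms module_tensor[OF assms(1,2)] module_tensor[OF assms(2,3)]
    module_tensor[OF module_tensor[OF assms(1,2)] assms(3)]
  note b1 = bilinear_map_pure_tensor[OF assms(1,2)]
    and b2 = bilinear_map_pure_tensor[OF module_tensor[OF assms(1,2)] assms(3)]
  have 1: "bilinear_map K N P ?Q (\<lambda>n p. ?\<phi> n p m)" if "m \<in> carrier M" for m
    by (rule bilinear_map_comp[OF b2 bilinear_map_right[OF b1 that] linear_map_id linear_map_id])
  have 2: "linear_map K M ?Q (?\<phi> n p)" if "n \<in> carrier N" "p \<in> carrier P" for n p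
    by (rule linear_map_comp[OF bilinear_map_left[OF b1 that(1)] bilinear_map_left[OF b2 that(2)]])
  note 3 = bilinear_map_flip[OF linear_map_tensor_lift_param[where \<phi> = ?\<phi>, OF assms(2,3,1) mod(6) 1 2]]
  show "linear_map K (tensor K M (tensor K N P)) ?Q (tensor_assoc_inv K M N P)"
    unfolding tensor_assoc_inv_def by (rule linear_map_tensor_lift[OF mod(1,5,6) 3])
  show "tensor_assoc_inv K M N P (pure_tensor K M (tensor K N P) m (pure_tensor K N P n p)) = ?\<phi> n p m"
    if "m \<in> carrier M" "n \<in> carrier N" "p \<in> carrier P" for m n p
    unfolding tensor_assoc_inv_def
    by (simp only: tensor_lift_pure_tensor[OF mod(1,5,6) 3] that pure_tensor_closed[OF assms(2,3)]
        tensor_lift_pure_tensor[where \<phi> = "\<lambda>n p. ?\<phi> n p m", OF assms(2,3) mod(6) 1])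
qed

subsection \<open>The twisted multiplication\<close>

context
  fixes K :: "('k, 'z) ring_scheme" and A :: "('k, 'a) module" and B :: "('k, 'b) module"
    and \<tau> :: "('b \<times> 'a \<Rightarrow> 'k) set \<Rightarrow> ('a \<times> 'b \<Rightarrow> 'k) set"
  assumes A: "module K A" and B: "module K B"
    and mult_A: "bilinear_map K A A A (monoid.mult A)" and mult_B: "bilinear_map K B B B (monoid.mult B)"
    and \<tau>: "linear_map K (tensor K B A) (tensor K A B) \<tau>"
begin

text \<open>In general \<open>\<tau>\<close> sends a pure tensor to a sum of pure tensors. The value
  is computed only where it is a single one, \<open>a''\<close> tensor \<open>b''\<close>; this
  covers the generators, and the rest follows by linearity.\<close>

lemma twisted_mult:
  shows linear_map_twisted_mult:
      "linear_map K (tensor K (tensor K A B) (tensor K A B)) (tensor K A B) (twisted_mult K A B \<tau>)"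
    and twisted_mult_pure_tensor:
      "\<And>a b a' b' a'' b''. \<lbrakk>a \<in> carrier A; b \<in> carrier B; a' \<in> carrier A; b' \<in> carrier B;
          a'' \<in> carrier A; b'' \<in> carrier B; \<tau> (pure_tensor K B A b a') = pure_tensor K A B a'' b''\<rbrakk> \<Longrightarrow>
        twisted_mult K A B \<tau> (pure_tensor K (tensor K A B) (tensor K A B)
          (pure_tensor K A B a b) (pure_tensor K A B a' b')) =
        pure_tensor K A B (a \<otimes>\<^bsub>A\<^esub> a'') (b'' \<otimes>\<^bsub>B\<^esub> b')"
proof -
  note t = module_tensor
  let ?AB = "tensor K A B" and ?BA = "tensor K B A" and ?AA = "tensor K A A" and ?BB = "tensor K B B"
  have AB: "module K ?AB" and BA: "module K ?BA" and AA: "module K ?AA" and BB: "module K ?BB"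
    by (rule t A B)+
  let ?\<mu>A = "tensor_lift K A A A (monoid.mult A)" and ?\<mu>B = "tensor_lift K B B B (monoid.mult B)"
  have id: "linear_map K M M id" for M :: "('k, 'c) module"
    using linear_map_id[of K M] by (simp add: id_def)
  note \<mu>A = tensor_lift[OF A A A mult_A] and \<mu>B = tensor_lift[OF B B B mult_B]
  \<comment> \<open>\<open>f1\<close> to \<open>f6\<close> are the six factors of the composite in
    the order of application, and \<open>g2\<close>, \<open>g3\<close>, \<open>g4\<close> are the
    maps inside \<open>f2\<close>, \<open>f3\<close>, \<open>f4\<close>. In each of them fact (1) is
    linearity and fact (2) the value on pure tensors.\<close>
  note f1 = tensor_assoc[OF A B AB]
  note g2 = tensor_assoc_inv[OF B A B]
  note f2 = tensor_map[OF A t[OF B AB] A t[OF BA B] id g2(1)]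
  note g3 = tensor_map[OF BA B AB B \<tau> id]
  note f3 = tensor_map[OF A t[OF BA B] A t[OF AB B] id g3(1)]
  note g4 = tensor_assoc[OF A B B]
  note f4 = tensor_map[OF A t[OF AB B] A t[OF A BB] id g4(1)]
  note f5 = tensor_assoc_inv[OF A A BB]
  note f6 = tensor_map[OF AA BB A B \<mu>A(1) \<mu>B(1)]
  show "linear_map K (tensor K ?AB ?AB) ?AB (twisted_mult K A B \<tau>)"
    unfolding twisted_mult_def Let_def Fun.comp_def
    by (rule linear_map_comp[OF linear_map_comp[OF linear_map_comp[OF linear_map_comp[OF
          linear_map_comp[OF f1(1) f2(1)] f3(1)] f4(1)] f5(1)] f6(1)])
  fix a b a' b' a'' b''
  assume [simp]: "a \<in> carrier A" "b \<in> carrier B" "a' \<in> carrier A" "b' \<in> carrier B"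
      "a'' \<in> carrier A" "b'' \<in> carrier B" "\<tau> (pure_tensor K B A b a') = pure_tensor K A B a'' b''"
  note [simp] = pure_tensor_closed[OF A B] pure_tensor_closed[OF B A] pure_tensor_closed[OF A A] pure_tensor_closed[OF B B]
    pure_tensor_closed[OF B AB] pure_tensor_closed[OF BA B] pure_tensor_closed[OF AB B] pure_tensor_closed[OF A BB]
  show "twisted_mult K A B \<tau> (pure_tensor K ?AB ?AB (pure_tensor K A B a b) (pure_tensor K A B a' b')) =
        pure_tensor K A B (a \<otimes>\<^bsub>A\<^esub> a'') (b'' \<otimes>\<^bsub>B\<^esub> b')"
    unfolding twisted_mult_def Let_def Fun.comp_def
    by (simp add: f1(2) f2(2) g2(2) f3(2) g3(2) f4(2) g4(2) f5(2) f6(2) \<mu>A(2) \<mu>B(2))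
qed

end

subsection \<open>Tensor products of families\<close>

text \<open>For empty \<open>I\<close> the second clause is vacuous, so membership of the values in
  \<open>carrier P\<close> has a clause of its own.\<close>

definition multilinear_map ::
  "('k, 'z) ring_scheme \<Rightarrow> 'i set \<Rightarrow> ('i \<Rightarrow> ('k, 'a) module) \<Rightarrow> ('k, 'p) module \<Rightarrow> (('i \<Rightarrow> 'a) \<Rightarrow> 'p) \<Rightarrow> bool" where
  "multilinear_map K I M P \<phi> \<longleftrightarrow>
    (\<forall>r\<in>\<Pi>\<^sub>E i\<in>I. carrier (M i). \<phi> r \<in> carrier P) \<and>
    (\<forall>r\<in>\<Pi>\<^sub>E i\<in>I. carrier (M i). \<forall>i\<in>I. linear_map K (M i) P (\<lambda>a. \<phi> (r(i := a))))"

lemma multilinear_map_closed: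
  "\<lbrakk>multilinear_map K I M P \<phi>; r \<in> (\<Pi>\<^sub>E i\<in>I. carrier (M i))\<rbrakk> \<Longrightarrow> \<phi> r \<in> carrier P"
  by (simp add: multilinear_map_def)

lemma multilinear_map_linear:
  "\<lbrakk>multilinear_map K I M P \<phi>; r \<in> (\<Pi>\<^sub>E i\<in>I. carrier (M i)); i \<in> I\<rbrakk> \<Longrightarrow>
    linear_map K (M i) P (\<lambda>a. \<phi> (r(i := a)))"
  by (simp add: multilinear_map_def)

lemma tensor_family_relationsI:
  fixes K (structure) and I :: "'i set" and M :: "'i \<Rightarrow> ('k, 'a) module"
  defines "S \<equiv> \<Pi>\<^sub>E i\<in>I. carrier (M i)"
  defines "L \<equiv> free_module K S" and "e \<equiv> basis_elem K S"
  shows "\<lbrakk>r \<in> S; i \<in> I; a \<in> carrier (M i); b \<in> carrier (M i)\<rbrakk> \<Longrightarrow>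
      e (r(i := a \<oplus>\<^bsub>M i\<^esub> b)) \<ominus>\<^bsub>L\<^esub> (e (r(i := a)) \<oplus>\<^bsub>L\<^esub> e (r(i := b))) \<in> tensor_family_relations K I M"
    and "\<lbrakk>r \<in> S; i \<in> I; c \<in> carrier K; a \<in> carrier (M i)\<rbrakk> \<Longrightarrow>
      e (r(i := c \<odot>\<^bsub>M i\<^esub> a)) \<ominus>\<^bsub>L\<^esub> (c \<odot>\<^bsub>L\<^esub> e (r(i := a))) \<in> tensor_family_relations K I M"
  unfolding tensor_family_relations_def Let_def S_def L_def e_def
  subgoal by (rule UnI1, rule CollectI, rule exI[of _ r], rule exI[of _ i], rule exI[of _ a], rule exI[of _ b]) simp
  subgoal by (rule UnI2, rule CollectI, rule exI[of _ r], rule exI[of _ i], rule exI[of _ c], rule exI[of _ a]) simp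
  done

context
  fixes K :: "('k, 'z) ring_scheme" and I :: "'i set" and M :: "'i \<Rightarrow> ('k, 'a) module"
  assumes K: "cring K" and M: "\<And>i. i \<in> I \<Longrightarrow> module K (M i)"
begin

lemma fun_upd_closed:
  "\<lbrakk>r \<in> (\<Pi>\<^sub>E i\<in>I. carrier (M i)); i \<in> I; a \<in> carrier (M i)\<rbrakk> \<Longrightarrow> r(i := a) \<in> (\<Pi>\<^sub>E i\<in>I. carrier (M i))"
  by (auto simp: PiE_iff extensional_def)

lemma presentation_tensor_family:
  "presentation K (\<Pi>\<^sub>E i\<in>I. carrier (M i)) (tensor_family_relations K I M)"
proof (rule presentation.intro)
  interpret L: module K "free_module K (\<Pi>\<^sub>E i\<in>I. carrier (M i))"
    by (rule module_free_module) (rule K)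
  note e = basis_elem_closed[OF K] fun_upd_closed
  note c = abelian_groupE(1)[OF module.axioms(2)[OF M]] module.smult_closed[OF M]
  show "tensor_family_relations K I M \<subseteq> carrier (free_module K (\<Pi>\<^sub>E i\<in>I. carrier (M i)))"
    unfolding tensor_family_relations_def Let_def
    by (intro Un_least subsetI; elim CollectE exE conjE) (simp_all add: e c)
qed (rule K)

interpretation T: presentation K "\<Pi>\<^sub>E i\<in>I. carrier (M i)" "tensor_family_relations K I M"
  by (rule presentation_tensor_family)

lemma tensor_family_eq_Q: "tensor_family K I M = T.Q"
  by (simp add: tensor_family_def tensor_family_null_def)

lemma pure_tensor_family_eq_gen: "pure_tensor_family K I M r = T.gen r"
  by (simp add: pure_tensor_family_def tensor_family_null_def)

lemma module_tensor_family: "module K (tensor_family K I M)"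
  unfolding tensor_family_eq_Q by (rule T.module_Q)

lemma multilinear_map_pure_tensor_family:
  "multilinear_map K I M (tensor_family K I M) (pure_tensor_family K I M)"
proof -
  let ?S = "\<Pi>\<^sub>E i\<in>I. carrier (M i)"
  let ?L = "free_module K ?S"
  let ?e = "basis_elem K ?S"
  interpret L: module K ?L by (rule T.module_L)
  note e = basis_elem_closed[OF K] fun_upd_closed
  note c = abelian_groupE(1)[OF module.axioms(2)[OF M]] module.smult_closed[OF M]
  have rel: "T.gen s = T.null +>\<^bsub>?L\<^esub> w"
    if "s \<in> ?S" "w \<in> carrier ?L" "?e s \<ominus>\<^bsub>?L\<^esub> w \<in> tensor_family_relations K I M" for s w
    using that by (intro T.proj_eqI e)
  show ?thesis
    unfolding multilinear_map_def tensor_family_eq_Q pure_tensor_family_eq_gen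
  proof (intro conjI ballI linear_mapI T.gen_closed)
    fix r i a assume r: "r \<in> ?S" "i \<in> I" "a \<in> carrier (M i)"
    then show "r(i := a) \<in> ?S" by (rule fun_upd_closed)
    show "T.gen (r(i := a \<oplus>\<^bsub>M i\<^esub> b)) = T.gen (r(i := a)) \<oplus>\<^bsub>T.Q\<^esub> T.gen (r(i := b))"
      if b: "b \<in> carrier (M i)" for b
    proof -
      have "T.gen (r(i := a \<oplus>\<^bsub>M i\<^esub> b)) = T.null +>\<^bsub>?L\<^esub> (?e (r(i := a)) \<oplus>\<^bsub>?L\<^esub> ?e (r(i := b)))"
        using r b by (intro rel tensor_family_relationsI) (simp_all add: e c)
      then show ?thesis
        using r b by (simp add: e linear_map_add[OF T.proj])
    qed
    show "T.gen (r(i := k \<odot>\<^bsub>M i\<^esub> a)) = k \<odot>\<^bsub>T.Q\<^esub> T.gen (r(i := a))"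
      if k: "k \<in> carrier K" for k
    proof -
      have "T.gen (r(i := k \<odot>\<^bsub>M i\<^esub> a)) = T.null +>\<^bsub>?L\<^esub> (k \<odot>\<^bsub>?L\<^esub> ?e (r(i := a)))"
        using r k by (intro rel tensor_family_relationsI) (simp_all add: e c)
      then show ?thesis
        using r k by (simp add: e linear_map_smult[OF T.proj])
    qed
  qed
qed

lemma tensor_family_linear_map_eqI:
  assumes "module K P" "linear_map K (tensor_family K I M) P g" "linear_map K (tensor_family K I M) P h"
    and "\<And>r. r \<in> (\<Pi>\<^sub>E i\<in>I. carrier (M i)) \<Longrightarrow> g (pure_tensor_family K I M r) = h (pure_tensor_family K I M r)"
    and "u \<in> carrier (tensor_family K I M)"
  shows "g u = h u"
  by (rule T.linear_map_eqI[OF assms(1) assms(2,3)[unfolded tensor_family_eq_Q]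
        assms(4)[unfolded pure_tensor_family_eq_gen] assms(5)[unfolded tensor_family_eq_Q]])

text \<open>The relations are written with updates \<open>r(i := a)\<close>, the same shape in which
  multilinearity is stated; hence the linear extension of \<open>\<phi>\<close> kills them and the
  lift is well defined.\<close>

lemma tensor_family_lift:
  assumes P: "module K P" and \<phi>: "multilinear_map K I M P \<phi>"
  shows linear_map_tensor_family_lift: "linear_map K (tensor_family K I M) P (tensor_family_lift K I M P \<phi>)"
    and tensor_family_lift_pure_tensor_family: "\<And>r. r \<in> (\<Pi>\<^sub>E i\<in>I. carrier (M i)) \<Longrightarrow>
      tensor_family_lift K I M P \<phi> (pure_tensor_family K I M r) = \<phi> r"
proof -
  interpret P: module K P by (rule P)
  let ?S = "\<Pi>\<^sub>E i\<in>I. carrier (M i)"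
  let ?L = "free_module K ?S"
  let ?e = "basis_elem K ?S"
  interpret L: module K ?L by (rule T.module_L)
  note cl = multilinear_map_closed[OF \<phi>]
  note c = abelian_groupE(1)[OF module.axioms(2)[OF M]] module.smult_closed[OF M]
  note ext = linear_map_linear_ext[where \<phi> = \<phi>, OF K P cl] linear_ext_basis_elem[where \<phi> = \<phi>, OF K P cl]
  note lin = multilinear_map_linear[OF \<phi>]
  note [simp] = ext(2) c basis_elem_closed[OF K] fun_upd_closed cl
    linear_map_minus[OF T.module_L P ext(1)] linear_map_add[OF ext(1)] linear_map_smult[OF ext(1)]
    linear_map_add[OF lin] linear_map_smult[OF lin]
  have [simp]: "x \<ominus>\<^bsub>P\<^esub> x = \<zero>\<^bsub>P\<^esub>" if "x \<in> carrier P" for x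
    using that by (simp add: a_minus_def P.M.r_neg)
  have resp: "linear_ext K ?S P \<phi> g = \<zero>\<^bsub>P\<^esub>" if "g \<in> tensor_family_relations K I M" for g
    using that unfolding tensor_family_relations_def Let_def
    by (elim UnE CollectE exE conjE) simp_all
  show "linear_map K (tensor_family K I M) P (tensor_family_lift K I M P \<phi>)"
    unfolding tensor_family_lift_def tensor_family_eq_Q by (rule T.linear_map_class_lift[OF P cl resp])
  show "tensor_family_lift K I M P \<phi> (pure_tensor_family K I M r) = \<phi> r" if "r \<in> ?S" for r
    unfolding tensor_family_lift_def pure_tensor_family_eq_gen
    using that by (simp only: T.class_lift_gen[OF P cl resp])
qed

end

section \<open>Auxiliary facts on bilinear maps, direct sums and finite sums with one surviving
  term\<close>

lemma bilinear_map_mult_one_update [simp]: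
  "bilinear_map K (M\<lparr>monoid.mult := m, one := e\<rparr>) N P \<phi> \<longleftrightarrow> bilinear_map K M N P \<phi>"
  "bilinear_map K M' (N'\<lparr>monoid.mult := m', one := e'\<rparr>) P' \<phi>' \<longleftrightarrow> bilinear_map K M' N' P' \<phi>'"
  "bilinear_map K M'' N'' (P''\<lparr>monoid.mult := m'', one := e''\<rparr>) \<phi>'' \<longleftrightarrow> bilinear_map K M'' N'' P'' \<phi>''"
  by (simp_all add: bilinear_map_def)

lemma bilinear_map_sum:
  assumes "module K M" "module K N" "module K P" "finite I" "\<And>i. i \<in> I \<Longrightarrow> bilinear_map K M N P (\<phi> i)"
  shows "bilinear_map K M N P (\<lambda>m n. \<Oplus>\<^bsub>P\<^esub>i\<in>I. \<phi> i m n)"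
  using assms(5) by (auto simp: bilinear_map_def intro!: linear_map_sum assms(1-4))

lemma bilinear_map_zero:
  assumes "module K M" "module K N" "module K P" "bilinear_map K M N P \<phi>"
  shows "n \<in> carrier N \<Longrightarrow> \<phi> \<zero>\<^bsub>M\<^esub> n = \<zero>\<^bsub>P\<^esub>" "m \<in> carrier M \<Longrightarrow> \<phi> m \<zero>\<^bsub>N\<^esub> = \<zero>\<^bsub>P\<^esub>"
  using linear_map_zero[OF assms(1,3) bilinear_map_left[OF assms(4)]]
    linear_map_zero[OF assms(2,3) bilinear_map_right[OF assms(4)]] by auto

lemma direct_sum_linear_map_eqI:
  assumes "cring K" "\<And>i. i \<in> I \<Longrightarrow> module K (M i)" "module K P"
    and "linear_map K (direct_sum K I M) P g" "linear_map K (direct_sum K I M) P h"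
    and "\<And>i a. \<lbrakk>i \<in> I; a \<in> carrier (M i)\<rbrakk> \<Longrightarrow> g (single I M i a) = h (single I M i a)"
    and "u \<in> carrier (direct_sum K I M)"
  shows "g u = h u"
proof -
  have "carrier (direct_sum K I M) \<subseteq> {u \<in> carrier (direct_sum K I M). g u = h u}"
    by (rule direct_sum_generated[OF assms(2) linear_map_equalizer[OF module_direct_sum[OF assms(1,2)] assms(3-5)]])
      (simp_all add: assms(6) linear_map_closed[OF linear_map_single[OF assms(2)]])
  with assms(7) show ?thesis by auto
qed

lemma (in abelian_monoid) finsum_eq_term:
  assumes "finite I" "i \<in> I" "f i \<in> carrier G" "\<And>j. \<lbrakk>j \<in> I; j \<noteq> i\<rbrakk> \<Longrightarrow> f j = \<zero>"
  shows "(\<Oplus>j\<in>I. f j) = f i"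
proof -
  have "(\<Oplus>j\<in>I. f j) = (\<Oplus>j\<in>I. if i = j then f i else \<zero>)"
    by (rule finsum_cong') (use assms in auto)
  also have "\<dots> = f i"
    using add.finprod_singleton[of i I "\<lambda>_. f i"] assms(1-3) by (simp add: Pi_def cong: if_cong)
  finally show ?thesis .
qed

text \<open>Made for the products of two generators: the double sum over all pairs of morphisms
  collapses to the pair where the generators sit.\<close>

lemma (in abelian_monoid) finsum_finsum_eq_term:
  assumes "finite I" "finite J" "i \<in> I" "j \<in> J" "f i j \<in> carrier G"
    and "\<And>i' j'. \<lbrakk>i' \<in> I; j' \<in> J; i' \<noteq> i \<or> j' \<noteq> j\<rbrakk> \<Longrightarrow> f i' j' = \<zero>"
  shows "(\<Oplus>i\<in>I. \<Oplus>j\<in>J. f i j) = f i j"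
proof -
  have inner: "(\<Oplus>j\<in>J. f i j) = f i j"
    by (rule finsum_eq_term) (use assms in auto)
  have "(\<Oplus>i\<in>I. \<Oplus>j\<in>J. f i j) = (\<Oplus>j\<in>J. f i j)"
    by (rule finsum_eq_term) (use assms inner in \<open>auto intro!: add.finprod_one_eqI\<close>)
  with inner show ?thesis by simp
qed

subsection \<open>Algebras from bilinear multiplications\<close>

text \<open>Bilinearity of the product already contains closure, distributivity and compatibility
  with scalars, which leaves associativity and the unit laws.\<close>

lemma unital_algebraI:
  assumes "module K M" "bilinear_map K M M M (monoid.mult M)" "\<one>\<^bsub>M\<^esub> \<in> carrier M"
    and "\<And>x y z. \<lbrakk>x \<in> carrier M; y \<in> carrier M; z \<in> carrier M\<rbrakk> \<Longrightarrow>
      (x \<otimes>\<^bsub>M\<^esub> y) \<otimes>\<^bsub>M\<^esub> z = x \<otimes>\<^bsub>M\<^esub> (y \<otimes>\<^bsub>M\<^esub> z)"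
    and "\<And>x. x \<in> carrier M \<Longrightarrow> \<one>\<^bsub>M\<^esub> \<otimes>\<^bsub>M\<^esub> x = x" "\<And>x. x \<in> carrier M \<Longrightarrow> x \<otimes>\<^bsub>M\<^esub> \<one>\<^bsub>M\<^esub> = x"
  shows "unital_algebra K M"
proof (intro unital_algebra.intro ringI monoidI unital_algebra_axioms.intro)
  note b = assms(2)
  fix x y assume xy: "x \<in> carrier M" "y \<in> carrier M"
  show "x \<otimes>\<^bsub>M\<^esub> y \<in> carrier M" by (rule bilinear_map_closed[OF b xy])
  show "(a \<odot>\<^bsub>M\<^esub> x) \<otimes>\<^bsub>M\<^esub> y = a \<odot>\<^bsub>M\<^esub> (x \<otimes>\<^bsub>M\<^esub> y)" "x \<otimes>\<^bsub>M\<^esub> (a \<odot>\<^bsub>M\<^esub> y) = a \<odot>\<^bsub>M\<^esub> (x \<otimes>\<^bsub>M\<^esub> y)"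
    if "a \<in> carrier K" for a
    using linear_map_smult[OF bilinear_map_left[OF b xy(2)] that xy(1)]
      linear_map_smult[OF bilinear_map_right[OF b xy(1)] that xy(2)] .
  fix z assume z: "z \<in> carrier M"
  show "(x \<oplus>\<^bsub>M\<^esub> y) \<otimes>\<^bsub>M\<^esub> z = x \<otimes>\<^bsub>M\<^esub> z \<oplus>\<^bsub>M\<^esub> y \<otimes>\<^bsub>M\<^esub> z"
    using linear_map_add[OF bilinear_map_left[OF b z] xy] .
  show "z \<otimes>\<^bsub>M\<^esub> (x \<oplus>\<^bsub>M\<^esub> y) = z \<otimes>\<^bsub>M\<^esub> x \<oplus>\<^bsub>M\<^esub> z \<otimes>\<^bsub>M\<^esub> y"
    using linear_map_add[OF bilinear_map_right[OF b z] xy] .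
qed (use assms module.axioms(2)[OF assms(1)] in auto)

lemma unital_algebra_module: "unital_algebra K M \<Longrightarrow> module K M"
  by (rule unital_algebra.axioms)

lemma unital_algebra_bilinear_map_mult:
  assumes "unital_algebra K M"
  shows "bilinear_map K M M M (monoid.mult M)"
proof -
  interpret unital_algebra K M by fact
  show ?thesis
    by (intro bilinear_mapI linear_mapI) (auto simp: M.l_distr M.r_distr smult_mult_left smult_mult_right)
qed

lemma alg_hom_linear_map: "h \<in> alg_hom K M N \<Longrightarrow> linear_map K M N h"
  by (auto simp: alg_hom_def ring_hom_def linear_map_def)

text \<open>Every element of \<open>B\<close> has the form \<open>h a\<close>, so each law of
  \<open>B\<close> pulls back to the same law in \<open>A\<close>. Thus \<open>B\<close> need not be
  known to be a ring beforehand. Used for the tensor product of the family and for the twisted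
  tensor product.\<close>

lemma unital_algebra_transport:
  assumes A: "unital_algebra K A" and B: "module K B" and h: "linear_map K A B h"
    and bij: "bij_betw h (carrier A) (carrier B)"
    and mult: "\<And>x y. \<lbrakk>x \<in> carrier A; y \<in> carrier A\<rbrakk> \<Longrightarrow> h (x \<otimes>\<^bsub>A\<^esub> y) = h x \<otimes>\<^bsub>B\<^esub> h y"
    and one: "h \<one>\<^bsub>A\<^esub> = \<one>\<^bsub>B\<^esub>"
  shows "unital_algebra K B" and "h \<in> alg_iso K A B"
proof -
  interpret A: unital_algebra K A by (rule A)
  interpret B: module K B by (rule B)
  have car: "carrier B = h ` carrier A"
    using bij by (simp add: bij_betw_def)
  note lin = linear_map_add[OF h, symmetric] linear_map_smult[OF h, symmetric]
  have "bilinear_map K B B B (monoid.mult B)"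
    unfolding bilinear_map_def linear_map_def car
    by (auto simp: lin mult[symmetric] A.M.l_distr A.M.r_distr A.smult_mult_left A.smult_mult_right)
  then show "unital_algebra K B"
    by (rule unital_algebraI[OF B])
      (auto simp: car mult[symmetric] A.M.m_assoc one[symmetric])
  show "h \<in> alg_iso K A B"
    using bij h by (auto simp: alg_iso_def alg_hom_def ring_hom_def mult one linear_map_def)
qed

subsection \<open>Category algebras and skew category algebras\<close>

context finite_category
begin

lemma bilinear_map_category_algebra:
  assumes "cring K"
  shows "bilinear_map K (category_algebra K C) (category_algebra K C) (category_algebra K C)
    (monoid.mult (category_algebra K C))"
proof -
  interpret K: cring K by fact
  let ?V = "free_module K (Mor C)"
  have V: "module K ?V" by (rule module_free_module) fact
  interpret V: module K ?V by (rule V)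
  have co: "v f \<in> carrier K" if "v \<in> carrier ?V" "f \<in> Mor C" for v f
    using that by (auto simp: free_module_def direct_sum_def self_module_def)
  have op: "(v \<oplus>\<^bsub>?V\<^esub> w) f = v f \<oplus>\<^bsub>K\<^esub> w f" "(c \<odot>\<^bsub>?V\<^esub> v) f = c \<otimes>\<^bsub>K\<^esub> v f" if "f \<in> Mor C" for v w c f
    using that by (auto simp: free_module_def direct_sum_def self_module_def)
  have "bilinear_map K ?V ?V ?V
      (\<lambda>v u. if dom C g = cod C f then (v g \<otimes>\<^bsub>K\<^esub> u f) \<odot>\<^bsub>?V\<^esub> basis_elem K (Mor C) (comp C g f) else \<zero>\<^bsub>?V\<^esub>)"
    if "g \<in> Mor C" "f \<in> Mor C" for g f
    using that basis_elem_closed[OF assms comp_closed[OF that]]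
    by (intro bilinear_mapI linear_mapI)
      (auto simp: co op K.l_distr K.r_distr K.m_assoc K.m_lcomm V.smult_l_distr V.smult_assoc1[symmetric])
  then show ?thesis
    unfolding category_algebra_def Let_def
    by (simp add: bilinear_map_sum V finite_Mor)
qed

lemma category_algebra_mult_basis_elem:
  assumes "cring K" "g \<in> Mor C" "f \<in> Mor C" "dom C g = cod C f"
  shows "basis_elem K (Mor C) g \<otimes>\<^bsub>category_algebra K C\<^esub> basis_elem K (Mor C) f = basis_elem K (Mor C) (comp C g f)"
proof -
  interpret K: cring K by fact
  let ?V = "free_module K (Mor C)"
  interpret V: module K ?V by (rule module_free_module) fact
  have e: "basis_elem K (Mor C) h h' = (if h' = h then \<one>\<^bsub>K\<^esub> else \<zero>\<^bsub>K\<^esub>)" if "h' \<in> Mor C" for h h'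
    using that by (simp add: basis_elem_def single_def self_module_def)
  note ec = basis_elem_closed[OF assms(1)]
  have "basis_elem K (Mor C) g \<otimes>\<^bsub>category_algebra K C\<^esub> basis_elem K (Mor C) f =
      (\<Oplus>\<^bsub>?V\<^esub>g'\<in>Mor C. \<Oplus>\<^bsub>?V\<^esub>f'\<in>Mor C. if dom C g' = cod C f'
        then (basis_elem K (Mor C) g g' \<otimes>\<^bsub>K\<^esub> basis_elem K (Mor C) f f') \<odot>\<^bsub>?V\<^esub>
          basis_elem K (Mor C) (comp C g' f') else \<zero>\<^bsub>?V\<^esub>)"
    by (simp add: category_algebra_def Let_def)
  also have "\<dots> = (if dom C g = cod C f then (basis_elem K (Mor C) g g \<otimes>\<^bsub>K\<^esub> basis_elem K (Mor C) f f) \<odot>\<^bsub>?V\<^esub>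
        basis_elem K (Mor C) (comp C g f) else \<zero>\<^bsub>?V\<^esub>)"
    by (rule V.M.finsum_finsum_eq_term) (use assms in \<open>auto simp: finite_Mor e ec comp_closed\<close>)
  also have "\<dots> = basis_elem K (Mor C) (comp C g f)"
    using assms by (simp add: e ec comp_closed)
  finally show ?thesis .
qed

end

section \<open>The skew category algebra of a precosheaf on a finite category\<close>

locale finite_precosheaf = precosheaf K C R F + finite_category C
  for K :: "('k, 'z) ring_scheme" and C :: "('o, 'm) category"
    and R :: "'o \<Rightarrow> ('k, 'a) module" and F :: "'m \<Rightarrow> 'a \<Rightarrow> 'a"
begin

abbreviation V where "V \<equiv> direct_sum K (Mor C) (\<lambda>f. R (cod C f))"
abbreviation "sgl \<equiv> single (Mor C) (\<lambda>f. R (cod C f))"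
abbreviation S where "S \<equiv> skew_category_algebra K C R F"

lemma module_cod: "f \<in> Mor C \<Longrightarrow> module K (R (cod C f))"
  by (intro unital_algebra_module algebra_obj cod_closed)

lemma module_V: "module K V"
  by (rule module_direct_sum[OF K.is_cring module_cod])

lemma linear_map_sgl: "f \<in> Mor C \<Longrightarrow> linear_map K (R (cod C f)) V (sgl f)"
  by (rule linear_map_single[OF module_cod])

lemmas sgl_closed = linear_map_closed[OF linear_map_sgl]

lemma linear_map_F: "\<lbrakk>f \<in> Mor C; dom C f = x\<rbrakk> \<Longrightarrow> linear_map K (R x) (R (cod C f)) (F f)"
  using alg_hom_linear_map[OF hom_mor] by blast

lemma skew_carrier [simp]: "carrier S = carrier V"
  by (simp add: skew_category_algebra_def Let_def)

lemma skew_zero [simp]: "\<zero>\<^bsub>S\<^esub> = \<zero>\<^bsub>V\<^esub>"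
  by (simp add: skew_category_algebra_def Let_def)

lemma module_S: "module K S"
  by (simp add: skew_category_algebra_def Let_def module_V)

lemma linear_map_S [simp]:
  "linear_map K S N h \<longleftrightarrow> linear_map K V N h" "linear_map K N S h' \<longleftrightarrow> linear_map K N V h'"
  by (simp_all add: skew_category_algebra_def Let_def)

text \<open>Each summand is a composite of linear maps with one bilinear map: take the components at
  \<open>g\<close> and \<open>f\<close>, apply \<open>F g\<close> to the second, multiply in
  \<open>R (cod C g)\<close>, and insert at the composite, whose codomain is again that of
  \<open>g\<close>.\<close>

lemma bilinear_map_skew: "bilinear_map K S S S (monoid.mult S)"
proof -
  interpret V: module K V by (rule module_V)
  have "bilinear_map K V V V
      (\<lambda>v u. if dom C g = cod C f then sgl (comp C g f) (v g \<otimes>\<^bsub>R (cod C g)\<^esub> F g (u f)) else \<zero>\<^bsub>V\<^esub>)"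
    if gf: "g \<in> Mor C" "f \<in> Mor C" for g f
  proof (cases "dom C g = cod C f")
    case True
    have "linear_map K V (R (cod C f)) (\<lambda>u. u f)" "linear_map K V (R (cod C g)) (\<lambda>v. v g)"
      using linear_map_component[OF gf(2), where K = K and M = "\<lambda>f. R (cod C f)"]
        linear_map_component[OF gf(1), where K = K and M = "\<lambda>f. R (cod C f)"] by auto
    moreover have "linear_map K (R (cod C f)) (R (cod C g)) (F g)"
      by (rule linear_map_F[OF gf(1) True])
    moreover have "linear_map K (R (cod C g)) V (sgl (comp C g f))"
      using linear_map_sgl[OF comp_closed[OF gf True]] by (simp add: cod_comp gf True)
    moreover have "bilinear_map K (R (cod C g)) (R (cod C g)) (R (cod C g)) (monoid.mult (R (cod C g)))"
      using gf by (intro unital_algebra_bilinear_map_mult algebra_obj cod_closed)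
    ultimately have "bilinear_map K V V V (\<lambda>v u. sgl (comp C g f) (v g \<otimes>\<^bsub>R (cod C g)\<^esub> F g (u f)))"
      by (intro bilinear_map_comp[where f = "\<lambda>v. v g" and g = "\<lambda>u. F g (u f)"] linear_map_comp[where f = "\<lambda>u. u f" and g = "F g"])
    with True show ?thesis by simp
  next
    case False
    then show ?thesis by (simp add: bilinear_map_def linear_map_const_zero[OF module_V])
  qed
  then show ?thesis
    unfolding skew_category_algebra_def Let_def
    by (simp add: bilinear_map_sum module_V finite_Mor)
qed

lemma skew_mult_sgl:
  assumes "g \<in> Mor C" "f \<in> Mor C" "s \<in> carrier (R (cod C g))" "r \<in> carrier (R (cod C f))"
  shows "sgl g s \<otimes>\<^bsub>S\<^esub> sgl f r =
    (if dom C g = cod C f then sgl (comp C g f) (s \<otimes>\<^bsub>R (cod C g)\<^esub> F g r) else \<zero>\<^bsub>V\<^esub>)"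
proof -
  interpret V: module K V by (rule module_V)
  have e: "sgl h a h' = (if h' = h then a else \<zero>\<^bsub>R (cod C h')\<^esub>)" if "h' \<in> Mor C" for h h' a
    using that by (simp add: single_def)
  \<comment> \<open>The other summands of the double sum vanish because zero is preserved at every
    stage: by \<open>F h\<close> (\<open>Fz\<close>), by multiplication (\<open>rs\<close>) and by
    insertion into the direct sum (\<open>sz\<close>).\<close>
  have Fz: "F h \<zero>\<^bsub>R (cod C f')\<^esub> = \<zero>\<^bsub>R (cod C h)\<^esub>" if "h \<in> Mor C" "f' \<in> Mor C" "dom C h = cod C f'" for h f'
    using linear_map_zero[OF module_cod module_cod linear_map_F] that by metis
  have Fc: "F h r \<in> carrier (R (cod C h))" if "h \<in> Mor C" "dom C h = cod C f" for h
    using linear_map_closed[OF linear_map_F[OF that] assms(4)] .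
  have ring: "ring (R (cod C h))" if "h \<in> Mor C" for h
    using algebra_obj[OF cod_closed[OF that]] by (rule unital_algebra.axioms)
  have sz: "sgl (comp C h h') \<zero>\<^bsub>R (cod C h)\<^esub> = \<zero>\<^bsub>V\<^esub>" if "h \<in> Mor C" "h' \<in> Mor C" "dom C h = cod C h'" for h h'
    using linear_map_zero[OF module_cod module_V linear_map_sgl] comp_closed[OF that] cod_comp[OF that] by metis
  note rs = ring.ring_simprules(24,25)[OF ring] ring.ring_simprules(2,5)[OF ring]
  have term_closed: "sgl (comp C g f) (s \<otimes>\<^bsub>R (cod C g)\<^esub> F g r) \<in> carrier V" if "dom C g = cod C f"
    using sgl_closed[OF comp_closed[OF assms(1,2) that]] assms(1-3) Fc that by (simp add: cod_comp rs)
  have "sgl g s \<otimes>\<^bsub>S\<^esub> sgl f r = (\<Oplus>\<^bsub>V\<^esub>g'\<in>Mor C. \<Oplus>\<^bsub>V\<^esub>f'\<in>Mor C. if dom C g' = cod C f'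
      then sgl (comp C g' f') (sgl g s g' \<otimes>\<^bsub>R (cod C g')\<^esub> F g' (sgl f r f')) else \<zero>\<^bsub>V\<^esub>)"
    by (simp add: skew_category_algebra_def Let_def)
  also have "\<dots> = (if dom C g = cod C f then sgl (comp C g f) (sgl g s g \<otimes>\<^bsub>R (cod C g)\<^esub> F g (sgl f r f)) else \<zero>\<^bsub>V\<^esub>)"
    by (rule V.M.finsum_finsum_eq_term)
      (use assms(1-3) term_closed in \<open>auto simp: finite_Mor e Fz Fc sz rs\<close>)
  finally show ?thesis using assms(1,2) by (simp add: e)
qed

text \<open>Identities embed the objects into the finite set of morphisms. Finiteness allows the sum
  defining the unit to be expanded by linearity.\<close>

lemma finite_Ob: "finite (Ob C)"
proof (rule finite_imageD)
  show "finite (ident C ` Ob C)"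
    by (rule finite_subset[OF _ finite_Mor]) (auto simp: ident_closed)
  show "inj_on (ident C) (Ob C)"
    by (rule inj_onI) (metis dom_ident)
qed

lemma one_obj_closed: "x \<in> Ob C \<Longrightarrow> \<one>\<^bsub>R x\<^esub> \<in> carrier (R x)"
  using unital_algebra.axioms(2)[OF algebra_obj] ring.ring_simprules(6) by blast

lemma skew_one: "\<one>\<^bsub>S\<^esub> = (\<Oplus>\<^bsub>V\<^esub>x\<in>Ob C. sgl (ident C x) \<one>\<^bsub>R x\<^esub>)"
  by (simp add: skew_category_algebra_def Let_def)

lemma sgl_ident_closed: "x \<in> Ob C \<Longrightarrow> sgl (ident C x) \<one>\<^bsub>R x\<^esub> \<in> carrier V"
  using sgl_closed[of "ident C x" "\<one>\<^bsub>R x\<^esub>"] by (simp add: ident_closed cod_ident one_obj_closed)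

lemma skew_eqI:
  assumes "module K P" "linear_map K S P g" "linear_map K S P h"
    and "\<And>f r. \<lbrakk>f \<in> Mor C; r \<in> carrier (R (cod C f))\<rbrakk> \<Longrightarrow> g (sgl f r) = h (sgl f r)"
    and "u \<in> carrier S"
  shows "g u = h u"
  by (rule direct_sum_linear_map_eqI[OF K.is_cring module_cod assms(1), where g = g and h = h])
    (use assms in auto)

text \<open>Of the identities that make up the unit, only the one at the codomain of
  \<open>f\<close> can be composed with \<open>f\<close> on the left, and only the one at the domain
  on the right; so a single summand remains.\<close>

lemma skew_one_mult_sgl:
  assumes f: "f \<in> Mor C" "r \<in> carrier (R (cod C f))"
  shows "\<one>\<^bsub>S\<^esub> \<otimes>\<^bsub>S\<^esub> sgl f r = sgl f r" "sgl f r \<otimes>\<^bsub>S\<^esub> \<one>\<^bsub>S\<^esub> = sgl f r"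
proof -
  interpret V: module K V by (rule module_V)
  have fr: "sgl f r \<in> carrier S" using sgl_closed[OF f] by simp
  have ring: "ring (R (cod C f))"
    using algebra_obj[OF cod_closed[OF f(1)]] by (rule unital_algebra.axioms)
  \<comment> \<open>Expanding by linearity yields a sum taken in the record \<open>S\<close>. It
    equals the sum in \<open>V\<close>, as the two records share carrier, addition and zero.\<close>
  have sum: "(\<Oplus>\<^bsub>S\<^esub>x\<in>I. t x) = (\<Oplus>\<^bsub>V\<^esub>x\<in>I. t x)" for I :: "'o set" and t
    by (simp add: skew_category_algebra_def Let_def finsum_def finprod_def)
  have "\<one>\<^bsub>S\<^esub> \<otimes>\<^bsub>S\<^esub> sgl f r = (\<Oplus>\<^bsub>V\<^esub>x\<in>Ob C. sgl (ident C x) \<one>\<^bsub>R x\<^esub> \<otimes>\<^bsub>S\<^esub> sgl f r)"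
    unfolding skew_one
    using linear_map_finsum[OF module_V module_S, where h = "\<lambda>v. v \<otimes>\<^bsub>S\<^esub> sgl f r", OF _ finite_Ob sgl_ident_closed]
      bilinear_map_left[OF bilinear_map_skew fr] by (simp add: sum)
  also have "\<dots> = sgl (ident C (cod C f)) \<one>\<^bsub>R (cod C f)\<^esub> \<otimes>\<^bsub>S\<^esub> sgl f r"
  proof (rule V.M.finsum_eq_term[OF finite_Ob cod_closed[OF f(1)]])
    show "sgl (ident C (cod C f)) \<one>\<^bsub>R (cod C f)\<^esub> \<otimes>\<^bsub>S\<^esub> sgl f r \<in> carrier V"
      using bilinear_map_closed[OF bilinear_map_skew _ fr] sgl_ident_closed[OF cod_closed[OF f(1)]]
      by (simp only: skew_carrier)
  qed (use f in \<open>simp add: skew_mult_sgl ident_closed cod_ident dom_ident one_obj_closed\<close>)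
  also have "\<dots> = sgl f r"
    using f by (simp add: skew_mult_sgl ident_closed cod_ident dom_ident one_obj_closed cod_closed
        comp_ident_left mor_ident ring.ring_simprules(12)[OF ring])
  finally show "\<one>\<^bsub>S\<^esub> \<otimes>\<^bsub>S\<^esub> sgl f r = sgl f r" .
  \<comment> \<open>The left unit law used that \<open>F\<close> sends identities to identities; the
    right one uses that \<open>F f\<close> preserves the unit.\<close>
  have F1: "F f \<one>\<^bsub>R (dom C f)\<^esub> = \<one>\<^bsub>R (cod C f)\<^esub>"
    using hom_mor[OF f(1)] by (auto simp: alg_hom_def ring_hom_def)
  have "sgl f r \<otimes>\<^bsub>S\<^esub> \<one>\<^bsub>S\<^esub> = (\<Oplus>\<^bsub>V\<^esub>x\<in>Ob C. sgl f r \<otimes>\<^bsub>S\<^esub> sgl (ident C x) \<one>\<^bsub>R x\<^esub>)"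
    unfolding skew_one
    using linear_map_finsum[OF module_V module_S, where h = "\<lambda>v. sgl f r \<otimes>\<^bsub>S\<^esub> v", OF _ finite_Ob sgl_ident_closed]
      bilinear_map_right[OF bilinear_map_skew fr] by (simp add: sum)
  also have "\<dots> = sgl f r \<otimes>\<^bsub>S\<^esub> sgl (ident C (dom C f)) \<one>\<^bsub>R (dom C f)\<^esub>"
  proof (rule V.M.finsum_eq_term[OF finite_Ob dom_closed[OF f(1)]])
    show "sgl f r \<otimes>\<^bsub>S\<^esub> sgl (ident C (dom C f)) \<one>\<^bsub>R (dom C f)\<^esub> \<in> carrier V"
      using bilinear_map_closed[OF bilinear_map_skew fr] sgl_ident_closed[OF dom_closed[OF f(1)]]
      by (simp only: skew_carrier)
  qed (use f in \<open>auto simp: skew_mult_sgl ident_closed cod_ident dom_ident one_obj_closed\<close>)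
  also have "\<dots> = sgl f r"
    using f by (simp add: skew_mult_sgl ident_closed cod_ident dom_ident one_obj_closed dom_closed
        comp_ident_right F1 monoid.r_one[OF ring.is_monoid[OF ring]])
  finally show "sgl f r \<otimes>\<^bsub>S\<^esub> \<one>\<^bsub>S\<^esub> = sgl f r" .
qed

text \<open>If all three are composable, multiplicativity of \<open>F h\<close> and functoriality
  turn both sides into \<open>t\<close> times \<open>F h s\<close> times \<open>F h (F g r)\<close>,
  placed at the triple composite. Otherwise both sides vanish, since a composite keeps the outer
  domain and codomain.\<close>

lemma skew_assoc_sgl:
  assumes "h \<in> Mor C" "g \<in> Mor C" "f \<in> Mor C"
    and "t \<in> carrier (R (cod C h))" "s \<in> carrier (R (cod C g))" "r \<in> carrier (R (cod C f))"
  shows "(sgl h t \<otimes>\<^bsub>S\<^esub> sgl g s) \<otimes>\<^bsub>S\<^esub> sgl f r = sgl h t \<otimes>\<^bsub>S\<^esub> (sgl g s \<otimes>\<^bsub>S\<^esub> sgl f r)"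
proof -
  have ring: "ring (R (cod C h))" if "h \<in> Mor C" for h
    using algebra_obj[OF cod_closed[OF that]] by (rule unital_algebra.axioms)
  have closed: "a \<otimes>\<^bsub>R (cod C k)\<^esub> F k b \<in> carrier (R (cod C k))"
    if "k \<in> Mor C" "dom C k = y" "a \<in> carrier (R (cod C k))" "b \<in> carrier (R y)" for k y a b
    using ring.ring_simprules(5)[OF ring[OF that(1)] that(3) linear_map_closed[OF linear_map_F[OF that(1,2)] that(4)]] .
  note zero = bilinear_map_zero[OF module_S module_S module_S bilinear_map_skew, unfolded skew_zero skew_carrier]
  show ?thesis
  proof (cases "dom C h = cod C g \<and> dom C g = cod C f")
    case True
    have Fh: "F h (s \<otimes>\<^bsub>R (cod C g)\<^esub> F g r) = F h s \<otimes>\<^bsub>R (cod C h)\<^esub> F h (F g r)"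
      using hom_mor[OF assms(1)] True assms linear_map_closed[OF linear_map_F[OF assms(2)] assms(6)]
      by (auto simp: alg_hom_def ring_hom_def)
    have "t \<otimes>\<^bsub>R (cod C h)\<^esub> F h s \<otimes>\<^bsub>R (cod C h)\<^esub> F h (F g r) =
        t \<otimes>\<^bsub>R (cod C h)\<^esub> (F h s \<otimes>\<^bsub>R (cod C h)\<^esub> F h (F g r))"
      using True assms linear_map_closed[OF linear_map_F[OF assms(2)] assms(6)]
        linear_map_closed[OF linear_map_F[OF assms(1)]]
      by (intro ring.ring_simprules(11)[OF ring]) auto
    with True assms show ?thesis
      by (simp add: skew_mult_sgl closed comp_closed cod_comp dom_comp comp_assoc mor_comp Fh)
  next
    case False
    with assms show ?thesis
      by (auto simp: skew_mult_sgl closed comp_closed cod_comp dom_comp zero sgl_closed)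
  qed
qed

lemma unital_algebra_skew: "unital_algebra K S"
proof (rule unital_algebraI[OF module_S bilinear_map_skew])
  interpret V: module K V by (rule module_V)
  note b = bilinear_map_skew
  note L = bilinear_map_left[OF b] and R = bilinear_map_right[OF b]
  show one: "\<one>\<^bsub>S\<^esub> \<in> carrier S"
    unfolding skew_one by (auto intro: V.M.finsum_closed sgl_ident_closed)
  show "\<one>\<^bsub>S\<^esub> \<otimes>\<^bsub>S\<^esub> u = u" if "u \<in> carrier S" for u
    by (rule skew_eqI[OF module_S R[OF one] linear_map_id skew_one_mult_sgl(1) that])
  show "u \<otimes>\<^bsub>S\<^esub> \<one>\<^bsub>S\<^esub> = u" if "u \<in> carrier S" for u
    by (rule skew_eqI[OF module_S L[OF one] linear_map_id skew_one_mult_sgl(2) that])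
  have sc: "sgl f r \<in> carrier S" if "f \<in> Mor C" "r \<in> carrier (R (cod C f))" for f r
    using sgl_closed[OF that] by simp
  \<comment> \<open>Associativity is extended from generators one variable at a time: first the
    right factor, then the middle one in \<open>2\<close>, then the left one. In each stage both
    sides are linear in that variable.\<close>
  have 1: "(sgl h t \<otimes>\<^bsub>S\<^esub> sgl g s) \<otimes>\<^bsub>S\<^esub> u = sgl h t \<otimes>\<^bsub>S\<^esub> (sgl g s \<otimes>\<^bsub>S\<^esub> u)"
    if "h \<in> Mor C" "g \<in> Mor C" "t \<in> carrier (R (cod C h))" "s \<in> carrier (R (cod C g))" "u \<in> carrier S" for h g t s u
    by (rule skew_eqI[OF module_S R[OF bilinear_map_closed[OF b]]
          linear_map_comp[OF R R] skew_assoc_sgl that(5)]) (use that sc in auto)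
  have 2: "(sgl h t \<otimes>\<^bsub>S\<^esub> v) \<otimes>\<^bsub>S\<^esub> u = sgl h t \<otimes>\<^bsub>S\<^esub> (v \<otimes>\<^bsub>S\<^esub> u)"
    if "h \<in> Mor C" "t \<in> carrier (R (cod C h))" "v \<in> carrier S" "u \<in> carrier S" for h t v u
    by (rule skew_eqI[OF module_S linear_map_comp[OF R L] linear_map_comp[OF L R] 1 that(3)])
      (use that sc in auto)
  show "(w \<otimes>\<^bsub>S\<^esub> v) \<otimes>\<^bsub>S\<^esub> u = w \<otimes>\<^bsub>S\<^esub> (v \<otimes>\<^bsub>S\<^esub> u)"
    if "w \<in> carrier S" "v \<in> carrier S" "u \<in> carrier S" for w v u
    by (rule skew_eqI[OF module_S linear_map_comp[OF L L] L 2 that(1)])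
      (use that bilinear_map_closed[OF b] in auto)
qed

end

section \<open>Bilinear maps on the category algebra given by coefficients along the
  morphisms\<close>

context finite_category
begin

context
  fixes K :: "('k, 'z) ring_scheme" and M :: "('k, 'c) module" and P :: "('k, 'p) module" and G :: "'b \<Rightarrow> 'c \<Rightarrow> 'p"
  assumes M: "module K M" and P: "module K P" and G: "\<And>f. f \<in> Mor C \<Longrightarrow> linear_map K M P (G f)"
begin

interpretation P: module K P by (rule P)

text \<open>Since the category algebra is free on the morphisms, a family of linear maps
  \<open>G f\<close> is the same as a bilinear map. The pattern occurs twice: in
  \<open>twist\<close>, and in the inverse of the comparison map.\<close>

lemma bilinear_map_coefficients:
  "bilinear_map K (category_algebra K C) M P (\<lambda>b m. \<Oplus>\<^bsub>P\<^esub>f\<in>Mor C. b f \<odot>\<^bsub>P\<^esub> G f m)"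
proof -
  let ?V = "free_module K (Mor C)"
  have V: "module K ?V" by (rule module_free_module[OF P.R.cring_axioms])
  have co: "v f \<in> carrier K" if "v \<in> carrier ?V" "f \<in> Mor C" for v f
    using that by (auto simp: free_module_def direct_sum_def self_module_def)
  have op: "(v \<oplus>\<^bsub>?V\<^esub> w) f = v f \<oplus>\<^bsub>K\<^esub> w f" "(c \<odot>\<^bsub>?V\<^esub> v) f = c \<otimes>\<^bsub>K\<^esub> v f" if "f \<in> Mor C" for v w c f
    using that by (auto simp: free_module_def direct_sum_def self_module_def)
  have "bilinear_map K ?V M P (\<lambda>b m. b f \<odot>\<^bsub>P\<^esub> G f m)" if f: "f \<in> Mor C" for f
  proof (rule bilinear_mapI)
    show "linear_map K ?V P (\<lambda>b. b f \<odot>\<^bsub>P\<^esub> G f m)" if "m \<in> carrier M" for m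
      using linear_map_closed[OF G[OF f] that] f
      by (intro linear_mapI) (auto simp: co op P.smult_l_distr P.smult_assoc1)
    show "linear_map K M P (\<lambda>m. b f \<odot>\<^bsub>P\<^esub> G f m)" if "b \<in> carrier ?V" for b
      by (rule linear_map_scale[OF P G[OF f] co[OF that f]])
  qed
  then show ?thesis
    unfolding category_algebra_def Let_def by (simp add: bilinear_map_sum V M P finite_Mor)
qed

lemma coefficients_basis_elem:
  assumes "f \<in> Mor C" "m \<in> carrier M"
  shows "(\<Oplus>\<^bsub>P\<^esub>g\<in>Mor C. basis_elem K (Mor C) f g \<odot>\<^bsub>P\<^esub> G g m) = G f m"
proof -
  have "(\<Oplus>\<^bsub>P\<^esub>g\<in>Mor C. basis_elem K (Mor C) f g \<odot>\<^bsub>P\<^esub> G g m) = basis_elem K (Mor C) f f \<odot>\<^bsub>P\<^esub> G f m"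
    by (rule P.M.finsum_eq_term)
      (use assms linear_map_closed[OF G] in \<open>auto simp: finite_Mor basis_elem_def single_def self_module_def\<close>)
  also have "\<dots> = G f m"
    using assms linear_map_closed[OF G] by (simp add: basis_elem_def single_def self_module_def)
  finally show ?thesis .
qed

end

end

subsection \<open>The one-object case\<close>

locale finite_monoid_precosheaf = finite_precosheaf K C R F
  for K :: "('k, 'z) ring_scheme" and C :: "('o, 'm) category"
    and R :: "'o \<Rightarrow> ('k, 'a) module" and F :: "'m \<Rightarrow> 'a \<Rightarrow> 'a" +
  fixes x :: 'o
  assumes Ob: "Ob C = {x}"
begin

abbreviation A where "A \<equiv> tensor_family_algebra K (Ob C) R"
abbreviation B where "B \<equiv> category_algebra K C"
abbreviation T where "T \<equiv> twisted_category_algebra K C R F"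
abbreviation e where "e \<equiv> basis_elem K (Mor C)"
abbreviation \<iota> where "\<iota> a \<equiv> pure_tensor_family K (Ob C) R (\<lambda>_\<in>Ob C. a)"
abbreviation AB where "AB \<equiv> tensor K A B"
abbreviation tns where "tns \<equiv> pure_tensor K A B"

lemma dom_x: "f \<in> Mor C \<Longrightarrow> dom C f = x" and cod_x: "f \<in> Mor C \<Longrightarrow> cod C f = x"
  using dom_closed cod_closed Ob by auto

lemma x_Ob: "x \<in> Ob C" by (simp add: Ob)

lemmas algebra_x = algebra_obj[OF x_Ob]
lemmas module_x = unital_algebra_module[OF algebra_x]

lemma module_Ob: "y \<in> Ob C \<Longrightarrow> module K (R y)"
  by (simp add: Ob module_x)

lemma linear_map_F_x: "f \<in> Mor C \<Longrightarrow> linear_map K (R x) (R x) (F f)"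
  using linear_map_F[of f x] by (simp add: dom_x cod_x)

text \<open>A family over a one-element set is determined by its entry at \<open>x\<close>; writing
  it as a constant restricted function gives the shape used by \<open>\<iota>\<close>.\<close>

lemma const_Ob: "r \<in> (\<Pi>\<^sub>E y\<in>Ob C. carrier (R y)) \<longleftrightarrow> (\<exists>a\<in>carrier (R x). r = (\<lambda>_\<in>Ob C. a))"
  by (auto simp: Ob PiE_iff extensional_def fun_eq_iff intro!: bexI[of _ "r x"])

lemma const_Ob_upd: "(\<lambda>_\<in>Ob C. a)(x := b) = (\<lambda>_\<in>Ob C. b)"
  by (auto simp: Ob fun_eq_iff)

text \<open>Updating a constant family at the only object gives another constant family, so the base
  family in the definition of multilinearity drops out.\<close>

lemma multilinear_map_iff:
  "multilinear_map K (Ob C) R P \<phi> \<longleftrightarrow> linear_map K (R x) P (\<lambda>a. \<phi> (\<lambda>_\<in>Ob C. a))"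
proof -
  interpret Rx: module K "R x" by (rule module_x)
  have PiE: "(\<Pi>\<^sub>E y\<in>Ob C. carrier (R y)) = (\<lambda>a. \<lambda>_\<in>Ob C. a) ` carrier (R x)"
    using const_Ob by blast
  have ball: "(\<forall>y\<in>Ob C. Q y) \<longleftrightarrow> Q x" for Q
    by (simp add: Ob)
  show ?thesis
    unfolding multilinear_map_def PiE ball ball_simps const_Ob_upd
    \<comment> \<open>The quantifier over base families is discharged at the zero family, which
      exists because the carrier contains zero.\<close>
    using Rx.M.zero_closed linear_map_closed[of K "R x" P "\<lambda>a. \<phi> (\<lambda>_\<in>Ob C. a)"] by blast
qed

section \<open>The tensor product of the family over a single object\<close>

lemma module_A: "module K A"
  by (simp add: tensor_family_algebra_def Let_def module_tensor_family K.is_cring module_Ob)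

lemma linear_map_A [simp]:
  "linear_map K A P h \<longleftrightarrow> linear_map K (tensor_family K (Ob C) R) P h"
  "linear_map K N A h' \<longleftrightarrow> linear_map K N (tensor_family K (Ob C) R) h'"
  by (simp_all add: tensor_family_algebra_def Let_def)

lemma carrier_A: "carrier A = carrier (tensor_family K (Ob C) R)"
  by (simp add: tensor_family_algebra_def Let_def)

lemma linear_map_iota: "linear_map K (R x) A \<iota>"
  using multilinear_map_pure_tensor_family[of K "Ob C" R] K.is_cring module_Ob
  by (simp add: multilinear_map_iff)

lemmas iota_closed = linear_map_closed[OF linear_map_iota]

lemma family_lift:
  assumes P: "module K P" and \<phi>: "linear_map K (R x) P (\<lambda>a. \<phi> (\<lambda>_\<in>Ob C. a))"
  shows linear_map_family_lift: "linear_map K A P (tensor_family_lift K (Ob C) R P \<phi>)"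
    and family_lift_iota: "\<And>a. a \<in> carrier (R x) \<Longrightarrow>
      tensor_family_lift K (Ob C) R P \<phi> (\<iota> a) = \<phi> (\<lambda>_\<in>Ob C. a)"
proof -
  note ml = \<phi>[folded multilinear_map_iff]
  show "linear_map K A P (tensor_family_lift K (Ob C) R P \<phi>)"
    unfolding linear_map_A by (rule linear_map_tensor_family_lift[OF K.is_cring module_Ob P ml])
  show "tensor_family_lift K (Ob C) R P \<phi> (\<iota> a) = \<phi> (\<lambda>_\<in>Ob C. a)" if "a \<in> carrier (R x)" for a
  proof -
    have "(\<lambda>_\<in>Ob C. a) \<in> (\<Pi>\<^sub>E y\<in>Ob C. carrier (R y))"
      unfolding const_Ob by (rule bexI[OF refl that])
    then show ?thesis
      by (simp only: tensor_family_lift_pure_tensor_family[OF K.is_cring module_Ob P ml])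
  qed
qed

text \<open>The inverse of \<open>\<iota>\<close>: reading off the entry at \<open>x\<close> is
  multilinear because there is only one entry.\<close>

abbreviation \<theta> where "\<theta> \<equiv> tensor_family_lift K (Ob C) R (R x) (\<lambda>r. r x)"

lemma linear_map_theta: "linear_map K A (R x) \<theta>"
  by (rule linear_map_family_lift[OF module_x]) (simp add: x_Ob linear_map_id)

lemma theta_iota: "a \<in> carrier (R x) \<Longrightarrow> \<theta> (\<iota> a) = a"
  by (subst family_lift_iota[OF module_x]) (simp_all add: x_Ob linear_map_id)

lemma iota_theta:
  assumes "u \<in> carrier A"
  shows "\<iota> (\<theta> u) = u"
proof (rule tensor_family_linear_map_eqI[OF K.is_cring module_Ob module_A, where g = "\<lambda>u. \<iota> (\<theta> u)" and h = "\<lambda>u. u"])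
  show "linear_map K (tensor_family K (Ob C) R) A (\<lambda>u. \<iota> (\<theta> u))"
    using linear_map_comp[OF linear_map_theta linear_map_iota] by simp
  show "linear_map K (tensor_family K (Ob C) R) A (\<lambda>u. u)"
    by (simp add: linear_map_id)
  show "\<iota> (\<theta> (pure_tensor_family K (Ob C) R r)) = pure_tensor_family K (Ob C) R r"
    if "r \<in> (\<Pi>\<^sub>E y\<in>Ob C. carrier (R y))" for r
    using that by (auto simp: const_Ob theta_iota)
qed (use assms in \<open>simp_all add: carrier_A\<close>)

lemma mult_iota:
  assumes a: "a \<in> carrier (R x)" and b: "b \<in> carrier (R x)"
  shows "\<iota> a \<otimes>\<^bsub>A\<^esub> \<iota> b = \<iota> (a \<otimes>\<^bsub>R x\<^esub> b)"
proof -
  let ?TF = "tensor_family K (Ob C) R"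
  let ?\<psi> = "\<lambda>r s. pure_tensor_family K (Ob C) R (\<lambda>i\<in>Ob C. r i \<otimes>\<^bsub>R i\<^esub> s i)"
  have TF: "module K ?TF" by (rule module_tensor_family[OF K.is_cring module_Ob])
  note bil = unital_algebra_bilinear_map_mult[OF algebra_x]
  have \<psi>: "?\<psi> (\<lambda>_\<in>Ob C. a) (\<lambda>_\<in>Ob C. b) = \<iota> (a \<otimes>\<^bsub>R x\<^esub> b)" for a b
    by (rule arg_cong[where f = "pure_tensor_family K (Ob C) R"]) (auto simp: Ob intro!: restrict_ext)
  have lin: "linear_map K (R x) ?TF (\<lambda>b. ?\<psi> (\<lambda>_\<in>Ob C. a) (\<lambda>_\<in>Ob C. b))" if "a \<in> carrier (R x)" for a
    unfolding \<psi> using linear_map_comp[OF bilinear_map_right[OF bil that] linear_map_iota] by simp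
  have inner: "tensor_family_lift K (Ob C) R ?TF (?\<psi> (\<lambda>_\<in>Ob C. a)) (\<iota> b) = \<iota> (a \<otimes>\<^bsub>R x\<^esub> b)"
    if "a \<in> carrier (R x)" for a
    using family_lift_iota[OF TF lin[OF that] b] by (simp only: \<psi>)
  have "linear_map K (R x) ?TF (\<lambda>a. \<iota> (a \<otimes>\<^bsub>R x\<^esub> b))"
    using linear_map_comp[OF bilinear_map_left[OF bil b] linear_map_iota] by simp
  then have "linear_map K (R x) ?TF (\<lambda>a. tensor_family_lift K (Ob C) R ?TF (?\<psi> (\<lambda>_\<in>Ob C. a)) (\<iota> b))"
    using linear_map_cong[OF module_x inner, where N = ?TF] by simp
  from family_lift_iota[where \<phi> = "\<lambda>r. tensor_family_lift K (Ob C) R ?TF (?\<psi> r) (\<iota> b)", OF TF this a]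
  show ?thesis
    unfolding inner[OF a] by (simp add: tensor_family_algebra_def Let_def)
qed

lemma one_A: "\<one>\<^bsub>A\<^esub> = \<iota> \<one>\<^bsub>R x\<^esub>"
proof -
  have "(\<lambda>i\<in>Ob C. \<one>\<^bsub>R i\<^esub>) = (\<lambda>_\<in>Ob C. \<one>\<^bsub>R x\<^esub>)"
    by (rule restrict_ext) (simp add: Ob)
  then show ?thesis by (simp add: tensor_family_algebra_def Let_def)
qed

text \<open>The laws come from \<open>R x\<close> along the bijection \<open>\<iota>\<close>, so
  associativity need not be checked through nested lifts.\<close>

lemma algebra_A: "unital_algebra K A"
proof (rule unital_algebra_transport(1)[OF algebra_x module_A linear_map_iota])
  show "bij_betw \<iota> (carrier (R x)) (carrier A)"
    by (rule bij_betwI[where g = \<theta>])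
      (auto simp: theta_iota iota_theta iota_closed linear_map_closed[OF linear_map_theta])
qed (simp_all add: mult_iota one_A)

lemmas bilinear_map_A = unital_algebra_bilinear_map_mult[OF algebra_A]
lemmas bilinear_map_B = bilinear_map_category_algebra[OF K.is_cring]

lemma module_B: "module K B"
  by (simp add: category_algebra_def Let_def module_free_module K.is_cring)

lemma e_closed: "f \<in> Mor C \<Longrightarrow> e f \<in> carrier B"
  by (simp add: category_algebra_def Let_def basis_elem_closed K.is_cring)

lemma one_B: "\<one>\<^bsub>B\<^esub> = e (ident C x)"
proof -
  interpret V: module K "free_module K (Mor C)" by (rule module_free_module[OF K.is_cring])
  show ?thesis
    by (simp add: category_algebra_def Let_def Ob basis_elem_closed K.is_cring ident_closed x_Ob)
qed

section \<open>Generators of the tensor product, the twist, and the twisted multiplication\<close>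

lemmas module_AB = module_tensor[OF module_A module_B]
lemmas tns_bilinear = bilinear_map_pure_tensor[OF module_A module_B]

lemma tns_linear: "f \<in> Mor C \<Longrightarrow> linear_map K (R x) AB (\<lambda>a. tns (\<iota> a) (e f))"
  by (rule linear_map_comp[OF linear_map_iota bilinear_map_left[OF tns_bilinear e_closed]])

text \<open>The tensors of \<open>\<iota> a\<close> with basis elements generate: every
  \<open>m\<close> in \<open>A\<close> is \<open>\<iota> (\<theta> m)\<close>, and the second factor
  is free on the morphisms.\<close>

lemma AB_eqI:
  assumes P: "module K P" and g: "linear_map K AB P g" and h: "linear_map K AB P h"
    and eq: "\<And>f a. \<lbrakk>f \<in> Mor C; a \<in> carrier (R x)\<rbrakk> \<Longrightarrow> g (tns (\<iota> a) (e f)) = h (tns (\<iota> a) (e f))"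
    and u: "u \<in> carrier AB"
  shows "g u = h u"
proof (rule tensor_linear_map_eqI[OF module_A module_B P g h _ u])
  fix m n assume m: "m \<in> carrier A" and n: "n \<in> carrier B"
  have lin: "linear_map K (free_module K (Mor C)) P (\<lambda>n. k (tns m n))" if "linear_map K AB P k" for k
    using linear_map_comp[OF bilinear_map_right[OF tns_bilinear m] that]
    unfolding category_algebra_def Let_def by simp
  show "g (tns m n) = h (tns m n)"
  proof (rule free_module_linear_map_eqI[OF K.is_cring P lin[OF g] lin[OF h]])
    show "g (tns m (e f)) = h (tns m (e f))" if "f \<in> Mor C" for f
      using eq[OF that linear_map_closed[OF linear_map_theta m]] by (simp add: iota_theta m)
    show "n \<in> carrier (free_module K (Mor C))"
      using n by (simp add: category_algebra_def Let_def)
  qed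
qed

lemma twist:
  shows linear_map_twist: "linear_map K (tensor K B A) AB (twist K C R F)"
    and twist_pure_tensor: "\<And>f a. \<lbrakk>f \<in> Mor C; a \<in> carrier (R x)\<rbrakk> \<Longrightarrow>
      twist K C R F (pure_tensor K B A (e f) (\<iota> a)) = tns (\<iota> (F f a)) (e f)"
proof -
  let ?\<phi> = "\<lambda>f r. tns (pure_tensor_family K (Ob C) R (twist_family C F f r)) (e f)"
  let ?G = "\<lambda>f. tensor_family_lift K (Ob C) R AB (?\<phi> f)"
  \<comment> \<open>Both \<open>dom C f\<close> and \<open>cod C f\<close> are \<open>x\<close>, so
    the twist overwrites the only entry. The result is the constant family of \<open>F f a\<close>,
    whose linearity in \<open>a\<close> makes the formula for \<open>\<tau>\<close> well
    defined.\<close>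
  have tw: "?\<phi> f (\<lambda>_\<in>Ob C. a) = tns (\<iota> (F f a)) (e f)" if "f \<in> Mor C" for f a
  proof -
    have "twist_family C F f (\<lambda>_\<in>Ob C. a) = (\<lambda>_\<in>Ob C. F f a)"
      unfolding twist_family_def by (rule restrict_ext) (simp add: Ob dom_x cod_x that)
    then show ?thesis by simp
  qed
  have "linear_map K (R x) AB (\<lambda>a. ?\<phi> f (\<lambda>_\<in>Ob C. a))" if "f \<in> Mor C" for f
    unfolding tw[OF that] by (rule linear_map_comp[OF linear_map_F_x[OF that] tns_linear[OF that]])
  note G = family_lift[OF module_AB this]
  note coeff = bilinear_map_coefficients[where G = ?G, OF module_A module_AB G(1)]
    coefficients_basis_elem[where G = ?G, OF module_A module_AB G(1)]
  show "linear_map K (tensor K B A) AB (twist K C R F)"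
    unfolding twist_def Let_def by (rule linear_map_tensor_lift[OF module_B module_A module_AB coeff(1)])
  show "twist K C R F (pure_tensor K B A (e f) (\<iota> a)) = tns (\<iota> (F f a)) (e f)"
    if "f \<in> Mor C" "a \<in> carrier (R x)" for f a
    unfolding twist_def Let_def
    by (simp only: tensor_lift_pure_tensor[OF module_B module_A module_AB coeff(1)] e_closed iota_closed
        that coeff(2) G(2) tw)
qed

lemma carrier_T: "carrier T = carrier AB"
  and mult_T: "u \<otimes>\<^bsub>T\<^esub> v = twisted_mult K A B (twist K C R F) (pure_tensor K AB AB u v)"
  and one_T: "\<one>\<^bsub>T\<^esub> = tns (\<iota> \<one>\<^bsub>R x\<^esub>) (e (ident C x))"
  and module_T: "module K T"
  and linear_map_T: "linear_map K N T h \<longleftrightarrow> linear_map K N AB h"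
  by (simp_all add: twisted_category_algebra_def twisted_tensor_def module_AB one_A one_B)

lemma bilinear_map_T: "bilinear_map K AB AB AB (monoid.mult T)"
  unfolding mult_T
  by (rule bilinear_map_comp[OF bilinear_map_pure_tensor[OF module_AB module_AB] linear_map_id linear_map_id
        linear_map_twisted_mult[OF module_A module_B bilinear_map_A bilinear_map_B linear_map_twist]])

lemma mult_T_tns:
  assumes "g \<in> Mor C" "f \<in> Mor C" "s \<in> carrier (R x)" "r \<in> carrier (R x)"
  shows "tns (\<iota> s) (e g) \<otimes>\<^bsub>T\<^esub> tns (\<iota> r) (e f) = tns (\<iota> (s \<otimes>\<^bsub>R x\<^esub> F g r)) (e (comp C g f))"
proof -
  have "tns (\<iota> s) (e g) \<otimes>\<^bsub>T\<^esub> tns (\<iota> r) (e f) = tns (\<iota> s \<otimes>\<^bsub>A\<^esub> \<iota> (F g r)) (e g \<otimes>\<^bsub>B\<^esub> e f)"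
    unfolding mult_T
    \<comment> \<open>Here \<open>a''\<close> is \<open>\<iota> (F g r)\<close> and
      \<open>b''\<close> is \<open>e g\<close>: moving \<open>e g\<close> past
      \<open>\<iota> r\<close> applies \<open>F g\<close> and leaves the morphism unchanged.\<close>
    by (rule twisted_mult_pure_tensor[OF module_A module_B bilinear_map_A bilinear_map_B linear_map_twist])
      (use assms in \<open>simp_all add: iota_closed e_closed linear_map_closed[OF linear_map_F_x] twist_pure_tensor\<close>)
  with assms show ?thesis
    by (simp add: mult_iota linear_map_closed[OF linear_map_F_x] category_algebra_mult_basis_elem
        K.is_cring dom_x cod_x)
qed

section \<open>The comparison map: linearity, bijectivity, multiplicativity\<close>

abbreviation \<Psi> where "\<Psi> \<equiv> Psi K C R"

lemma V_closed: "\<lbrakk>u \<in> carrier V; f \<in> Mor C\<rbrakk> \<Longrightarrow> u f \<in> carrier (R x)"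
  using linear_map_closed[OF linear_map_component[where M = "\<lambda>f. R (cod C f)"]] by (metis cod_x)

lemma Psi_eq:
  assumes "u \<in> carrier V"
  shows "\<Psi> u = (\<Oplus>\<^bsub>AB\<^esub>f\<in>Mor C. tns (\<iota> (u f)) (e f))"
proof -
  interpret AB: module K AB by (rule module_AB)
  \<comment> \<open>The only object is the codomain of \<open>f\<close>, so no entry is filled with
    a unit. This is what makes the summand linear in \<open>u f\<close>.\<close>
  have *: "(\<lambda>y\<in>Ob C. if y = cod C f then u f else \<one>\<^bsub>R y\<^esub>) = (\<lambda>_\<in>Ob C. u f)" if "f \<in> Mor C" for f
    by (rule restrict_ext) (simp add: Ob cod_x that)
  show ?thesis
    unfolding Psi_def Let_def
    by (rule AB.M.finsum_cong')
      (auto simp: * intro!: linear_map_closed[OF tns_linear] V_closed assms)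
qed

lemma linear_map_Psi: "linear_map K V AB \<Psi>"
proof -
  have "linear_map K V (R x) (\<lambda>u. u f)" if "f \<in> Mor C" for f
    using linear_map_component[OF that, where K = K and M = "\<lambda>f. R (cod C f)"] by (simp add: cod_x that)
  from linear_map_comp[OF this tns_linear]
  have "linear_map K V AB (\<lambda>u. \<Oplus>\<^bsub>AB\<^esub>f\<in>Mor C. tns (\<iota> (u f)) (e f))"
    by (intro linear_map_sum module_V module_AB finite_Mor)
  then show ?thesis
    using linear_map_cong[OF module_V Psi_eq] by simp
qed

lemma Psi_sgl:
  assumes "f \<in> Mor C" "r \<in> carrier (R x)"
  shows "\<Psi> (sgl f r) = tns (\<iota> r) (e f)"
proof -
  interpret AB: module K AB by (rule module_AB)
  have cl: "tns (\<iota> a) (e g) \<in> carrier AB" if "g \<in> Mor C" "a \<in> carrier (R x)" for g a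
    using linear_map_closed[OF tns_linear] that .
  have z: "tns (\<iota> \<zero>\<^bsub>R x\<^esub>) (e g) = \<zero>\<^bsub>AB\<^esub>" if "g \<in> Mor C" for g
    by (rule linear_map_zero[OF module_x module_AB tns_linear[OF that]])
  have s: "sgl f r g = (if g = f then r else \<zero>\<^bsub>R x\<^esub>)" if "g \<in> Mor C" for g
    using that by (simp add: single_def cod_x)
  have "\<Psi> (sgl f r) = (\<Oplus>\<^bsub>AB\<^esub>g\<in>Mor C. tns (\<iota> (sgl f r g)) (e g))"
    using assms by (intro Psi_eq sgl_closed) (simp_all add: cod_x)
  also have "\<dots> = tns (\<iota> (sgl f r f)) (e f)"
    by (rule AB.M.finsum_eq_term) (use assms in \<open>simp_all add: finite_Mor s z cl\<close>)
  also have "\<dots> = tns (\<iota> r) (e f)"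
    using assms by (simp add: s)
  finally show ?thesis .
qed

text \<open>The inverse \<open>?\<Phi>\<close> sends the tensor of \<open>a\<close> and
  \<open>b\<close> to the element with entry \<open>b f\<close> times \<open>\<theta> a\<close> at
  each \<open>f\<close>. Both composites are linear and fix the generators, hence they are
  identities.\<close>

lemma bij_betw_Psi: "bij_betw \<Psi> (carrier V) (carrier AB)"
proof -
  let ?G = "\<lambda>f a. sgl f (\<theta> a)"
  let ?\<beta> = "\<lambda>a b. \<Oplus>\<^bsub>V\<^esub>f\<in>Mor C. b f \<odot>\<^bsub>V\<^esub> ?G f a"
  let ?\<Phi> = "tensor_lift K A B V ?\<beta>"
  have G: "linear_map K A V (?G f)" if "f \<in> Mor C" for f
    by (rule linear_map_comp[OF linear_map_theta]) (use linear_map_sgl[OF that] in \<open>simp add: cod_x that\<close>)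
  note coeff = bilinear_map_coefficients[where G = ?G, OF module_A module_V G]
    coefficients_basis_elem[where G = ?G, OF module_A module_V G]
  \<comment> \<open>The coefficient lemmas take the category algebra as first argument, whereas it
    is the second tensor factor here; hence the flip.\<close>
  note lift = tensor_lift[OF module_A module_B module_V bilinear_map_flip[OF coeff(1)]]
  have \<Phi>: "?\<Phi> (tns (\<iota> a) (e f)) = sgl f a" if "f \<in> Mor C" "a \<in> carrier (R x)" for f a
  proof -
    have "?\<Phi> (tns (\<iota> a) (e f)) = sgl f (\<theta> (\<iota> a))"
      by (simp only: lift(2) iota_closed e_closed that coeff(2))
    then show ?thesis by (simp only: theta_iota[OF that(2)])
  qed
  show ?thesis
  proof (rule bij_betwI[where g = ?\<Phi>])
    show "\<Psi> \<in> carrier V \<rightarrow> carrier AB" "?\<Phi> \<in> carrier AB \<rightarrow> carrier V"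
      using linear_map_closed[OF linear_map_Psi] linear_map_closed[OF lift(1)] by auto
    show "?\<Phi> (\<Psi> u) = u" if "u \<in> carrier V" for u
    proof (rule skew_eqI[OF module_V, where g = "\<lambda>u. ?\<Phi> (\<Psi> u)" and h = "\<lambda>u. u"])
      show "linear_map K S V (\<lambda>u. ?\<Phi> (\<Psi> u))" "linear_map K S V (\<lambda>u. u)"
        using linear_map_comp[OF linear_map_Psi lift(1)] by (simp_all add: linear_map_id)
    qed (use that in \<open>simp_all add: cod_x Psi_sgl \<Phi>\<close>)
    show "\<Psi> (?\<Phi> w) = w" if "w \<in> carrier AB" for w
    proof (rule AB_eqI[OF module_AB linear_map_comp[OF lift(1) linear_map_Psi] linear_map_id _ that])
      fix f a assume fa: "f \<in> Mor C" "a \<in> carrier (R x)"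
      show "\<Psi> (?\<Phi> (tns (\<iota> a) (e f))) = tns (\<iota> a) (e f)"
        unfolding \<Phi>[OF fa] by (rule Psi_sgl[OF fa])
    qed
  qed
qed

text \<open>On generators both products are placed at \<open>comp C g f\<close> with the same
  coefficient, every pair being composable. Linearity extends this first to all right factors, then
  to all left ones.\<close>

lemma Psi_mult:
  assumes v: "v \<in> carrier S" and u: "u \<in> carrier S"
  shows "\<Psi> (v \<otimes>\<^bsub>S\<^esub> u) = \<Psi> v \<otimes>\<^bsub>T\<^esub> \<Psi> u"
proof -
  have \<Psi>: "linear_map K S AB \<Psi>" using linear_map_Psi by simp
  note cl = linear_map_closed[OF \<Psi>]
  have gen: "\<Psi> (sgl g s \<otimes>\<^bsub>S\<^esub> sgl f r) = \<Psi> (sgl g s) \<otimes>\<^bsub>T\<^esub> \<Psi> (sgl f r)"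
    if "g \<in> Mor C" "s \<in> carrier (R (cod C g))" "f \<in> Mor C" "r \<in> carrier (R (cod C f))" for g s f r
  proof -
    have "s \<otimes>\<^bsub>R x\<^esub> F g r \<in> carrier (R x)"
      using that linear_map_closed[OF linear_map_F_x]
        bilinear_map_closed[OF unital_algebra_bilinear_map_mult[OF algebra_x]] by (simp add: cod_x)
    with that show ?thesis
      by (simp add: skew_mult_sgl dom_x cod_x Psi_sgl comp_closed mult_T_tns)
  qed
  have 1: "\<Psi> (sgl g s \<otimes>\<^bsub>S\<^esub> u) = \<Psi> (sgl g s) \<otimes>\<^bsub>T\<^esub> \<Psi> u"
    if "g \<in> Mor C" "s \<in> carrier (R (cod C g))" for g s
  proof (rule skew_eqI[OF module_AB linear_map_comp[OF bilinear_map_right[OF bilinear_map_skew] \<Psi>]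
          linear_map_comp[OF \<Psi> bilinear_map_right[OF bilinear_map_T]] gen[OF that] u])
    show "sgl g s \<in> carrier S" using sgl_closed[OF that] by simp
    then show "\<Psi> (sgl g s) \<in> carrier AB" by (rule cl)
  qed
  show ?thesis
    by (rule skew_eqI[OF module_AB linear_map_comp[OF bilinear_map_left[OF bilinear_map_skew u] \<Psi>]
          linear_map_comp[OF \<Psi> bilinear_map_left[OF bilinear_map_T cl[OF u]]] 1 v])
qed

lemma Psi_one: "\<Psi> \<one>\<^bsub>S\<^esub> = \<one>\<^bsub>T\<^esub>"
proof -
  interpret V: module K V by (rule module_V)
  have "\<one>\<^bsub>S\<^esub> = sgl (ident C x) \<one>\<^bsub>R x\<^esub>"
    unfolding skew_one using sgl_ident_closed[OF x_Ob] by (simp add: Ob)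
  then show ?thesis
    by (simp add: Psi_sgl ident_closed x_Ob one_obj_closed one_T)
qed

lemma twisted_algebra_iso:
  "unital_algebra K T" "\<Psi> \<in> alg_iso K S T"
  using unital_algebra_transport[OF unital_algebra_skew module_T, of \<Psi>]
    linear_map_Psi bij_betw_Psi Psi_mult Psi_one by (simp_all add: linear_map_T carrier_T)

end

theorem corollary1p2:
  fixes K :: "('k, 'z) ring_scheme"
    and C :: "('o, 'm) category"
    and R :: "'o \<Rightarrow> ('k, 'a) module"
    and F :: "'m \<Rightarrow> 'a \<Rightarrow> 'a"
  assumes "field K"
    and "finite_category C"
    and "card (Ob C) = 1"
    and "precosheaf K C R F"
  shows "unital_algebra K (skew_category_algebra K C R F) \<and>
    unital_algebra K (twisted_category_algebra K C R F) \<and>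
    Psi K C R \<in> alg_iso K (skew_category_algebra K C R F) (twisted_category_algebra K C R F)"
proof -
  from assms(3) obtain x where x: "Ob C = {x}"
    by (auto simp: card_1_singleton_iff)
  interpret finite_monoid_precosheaf K C R F x
    by (intro finite_monoid_precosheaf.intro finite_precosheaf.intro finite_monoid_precosheaf_axioms.intro assms x)
  show ?thesis
    using unital_algebra_skew twisted_algebra_iso by simp
qed

end
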